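(* Let $(\phi_h,\mu_h,\vartheta_h)$ be any discrete solution of the fully discrete scheme (S) (defined in the context) with $\vartheta_h>0$. Then the scheme preserves the following structural properties (for every $0\le n\le n_\tau-1$): $$\langle d_\tau^{n+1}\phi_h,1\rangle=0\quad\text{(discrete mass conservation)},$$ $$\langle d_\tau^{n+1}e_h,1\rangle=\mathcal D_{\rm num}^{n+1}\le0\quad\text{(discrete energy dissipation)},$$ $$\langle d_\tau^{n+1}s_h,1\rangle=\mathcal D_h^{n+1}\ge0\quad\text{(discrete entropy production)},$$ where $e_h$ and $s_h$ denote the discrete internal energy and entropy, the discrete entropy production is $$\mathcal D_h^{n+1}=\int_\Omega \mathbf r^\top\begin{pmatrix}\mathbf K_h^*&-\mathbf C_h^*\\-\mathbf C_h^*&\mathbf M_h^*\end{pmatrix}\mathbf r\,dx,\qquad \mathbf r=\begin{pmatrix}\dfrac{\nabla\vartheta_h^{n+1}}{\vartheta_h^{n+1}\vartheta_h^*}\\[2mm] \dfrac{\mu_h^*}{\vartheta_h^{n+1}\vartheta_h^*}\nabla\vartheta_h^{n+1}-\dfrac{\nabla\mu_h^{n+1}}{\vartheta_h^{n+1}}\end{pmatrix},$$ and the numerical dissipation is $$\mathcal D_{\rm num}^{n+1}=-\tfrac\tau2\Big(\gamma\langle|\nabla d_\tau^{n+1}\phi_h|^2,\vartheta_h^{n+1}\rangle-\langle\partial_{\vartheta\vartheta}f(\phi_h^n,\zeta_1),(d_\tau^{n+1}\vartheta_h)^2\rangle+\langle\partial_{\phi\phi}f_{\rm vex}(\zeta_2,\vartheta_h^{n+1})-\partial_{\phi\phi}f_{\rm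 cav}(\zeta_3,\vartheta_h^{n+1}),(d_\tau^{n+1}\phi_h)^2\rangle\Big),$$ with $\zeta_1$ (between $\vartheta_h^n$ and $\vartheta_h^{n+1}$) and $\zeta_2,\zeta_3$ (between $\phi_h^n$ and $\phi_h^{n+1}$) the intermediate values, depending on the point of $\Omega$, from Taylor expansion of $f$ in $\vartheta$ and of $f_{\rm vex},f_{\rm cav}$ in $\phi$.
   Context: Domain and data. $\Omega\subset\mathbb R^d$, $d\in\{1,2,3\}$, is a cube identified with the $d$-dimensional torus; all functions on $\Omega$ are periodic; $\langle u,v\rangle=\int_\Omega u\cdot v\,dx$. $\gamma>0$ is a constant. $\mathbf M,\mathbf K,\mathbf C$ are $d\times d$-matrix-valued functions of $(\phi,\nabla\phi,\vartheta)$ such that $\mathbf L=\begin{pmatrix}\mathbf K&-\mathbf C\\-\mathbf C&\mathbf M\end{pmatrix}$ is positive definite: there are constants $\lambda_0,\lambda_1>0$ with $\lambda_0|\xi|^2\le\xi^\top\mathbf L\xi\le\lambda_1|\xi|^2$ for all $\xi\in\mathbb R^{2d}$. The driving potential $f:\mathbb R\times\mathbb R_+\to\mathbb R$, $(\phi,\vartheta)\mapsto f(\phi,\vartheta)$, is smooth; for each fixed $\phi$ the function $f(\phi,\cdot)$ is concave and diverges as $\vartheta\to0$; for each fixed $\vartheta>0$ the function $f(\cdot,\vartheta)$ is decomposed into a convex part $f_{\rm vex}(\cdot,\vartheta)$ and a concave part $f_{\rm cav}(\cdot,\vartheta)$, $f=f_{\rm vex}+f_{\rm cav}$. Entropy density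 $s(\phi,\nabla\phi,\vartheta)=-\frac\gamma2|\nabla\phi|^2-\partial_\vartheta f(\phi,\vartheta)$; internal energy density $e(\phi,\vartheta)=f(\phi,\vartheta)-\vartheta\,\partial_\vartheta f(\phi,\vartheta)$. Discretization. The time interval $[0,T]$ is partitioned uniformly with step size $\tau>0$; $n_\tau=T/\tau$ is the number of time steps, $t^n=n\tau$, $\mathcal I_\tau=\{t^0,\dots,t^{n_\tau}\}$. $\Pi^1_c(\mathcal I_\tau;X)$ and $\Pi^0(\mathcal I_\tau;X)$ are the continuous piecewise linear and the piecewise constant functions on this grid with values in $X$. $g^{n+1},g^n,g^*$ denote evaluation at $t^{n+1}$, $t^n$ and at some intermediate time $t^*\in[t^n,t^{n+1}]$, and $d_\tau^{n+1}g=(g^{n+1}-g^n)/\tau$. $\mathcal T_h$ is a geometrically conforming, periodically extendable triangulation of $\Omega$ into simplices with maximal diameter $h$, and $\mathcal V_h$ is the space of continuous (periodic) functions that are affine on each $K\in\mathcal T_h$. For $\mathbf X\in\{\mathbf M,\mathbf K,\mathbf C\}$, $\mathbf X_h^*=\mathbf X(\phi_h^*,\nabla\phi_h^*,\vartheta_h^* )$. $s_h^n=s(\phi_h^n,\nabla\phi_h^n,\vartheta_h^n)$, $e_h^n=e(\phi_h^n,\vartheta_h^n)$, and $f_\phi(\phi_h^{n+1},\phi_h^n,\vartheta_h^{n+1})=\partial_\phi f_{\rm vex}(\phi_h^{n+1},\vartheta_h^{n+1})+\partial_\phi f_{\rm cav}(\phi_h^n,\vartheta_h^{n+1})$. Scheme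 (S). Given initial data $(\phi_h^0,\vartheta_h^0)\in\mathcal V_h\times\mathcal V_h$, find $(\phi_h,\vartheta_h)\in\Pi^1_c(\mathcal I_\tau;\mathcal V_h\times\mathcal V_h)$ and $\mu_h\in\Pi^0(\mathcal I_\tau;\mathcal V_h)$ such that for all $(\psi_h,\xi_h,\omega_h)\in\mathcal V_h\times\mathcal V_h\times\mathcal V_h$ and all $0\le n\le n_\tau-1$: $$\langle d_\tau^{n+1}\phi_h,\psi_h\rangle=\Big\langle\tfrac{\mu_h^*}{\vartheta_h^*}\mathbf M_h^*\nabla\vartheta_h^{n+1}-\mathbf M_h^*\nabla\mu_h^{n+1}-\tfrac1{\vartheta_h^*}\mathbf C_h^*\nabla\vartheta_h^{n+1},\tfrac1{\vartheta_h^{n+1}}\nabla\psi_h\Big\rangle,$$ $$\langle\mu_h^{n+1},\xi_h\rangle=\gamma\langle\nabla\phi_h^{n+1},\vartheta_h^{n+1}\nabla\xi_h\rangle+\gamma\langle\nabla\phi_h^*,\xi_h\nabla\vartheta_h^{n+1}\rangle+\langle f_\phi(\phi_h^{n+1},\phi_h^n,\vartheta_h^{n+1}),\xi_h\rangle,$$ $$\langle d_\tau^{n+1}s_h,\omega_h\rangle=\Big\langle\tfrac1{\vartheta_h^*}\mathbf K_h^*\nabla\vartheta_h^{n+1}+\mathbf C_h^*\nabla\mu_h^{n+1}-2\tfrac{\mu_h^*}{\vartheta_h^*}\mathbf C_h^*\nabla\vartheta_h^{n+1}-\mu_h^*\mathbf M_h^*\nabla\mu_h^{n+1}+\tfrac{(\mu_h^*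 )^2}{\vartheta_h^*}\mathbf M_h^*\nabla\vartheta_h^{n+1},\ \tfrac{\omega_h}{(\vartheta_h^{n+1})^2\vartheta_h^*}\nabla\vartheta_h^{n+1}-\tfrac1{\vartheta_h^*\vartheta_h^{n+1}}\nabla\omega_h\Big\rangle$$ $$\quad+\Big\langle\tfrac1{\vartheta_h^*}\mathbf C_h^*\nabla\vartheta_h^{n+1}+\mathbf M_h^*\nabla\mu_h^{n+1}-\tfrac{\mu_h^*}{\vartheta_h^*}\mathbf M_h^*\nabla\vartheta_h^{n+1},\ \tfrac{\omega_h}{(\vartheta_h^{n+1})^2}\nabla\mu_h^{n+1}\Big\rangle+\gamma\langle\nabla\phi_h^*,d_\tau^{n+1}\phi_h\,\nabla\omega_h\rangle .$$ *)

theory Defs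
  imports "HOL-Analysis.Analysis"
begin

subsection \<open>The periodic cell and its triangulations\<close>

definition cube :: "real ^ 'd \<Rightarrow> real \<Rightarrow> (real ^ 'd) set" where
  "cube a l = cbox a (\<chi> i. a $ i + l)"

text \<open>Functions on the torus are represented by their periodic extensions to the whole space.\<close>

definition periodic :: "real \<Rightarrow> (real ^ 'd \<Rightarrow> 'b) \<Rightarrow> bool" where
  "periodic l u \<longleftrightarrow> (\<forall>x i. u (x + axis i l) = u x)"

text \<open>The last conjunct is periodic extendability: the translates of the mesh by the lattice of
  periods fit together conformingly.\<close>

definition periodic_mesh ::
    "real ^ 'd \<Rightarrow> real \<Rightarrow> real \<Rightarrow> (real ^ 'd) set set \<Rightarrow> bool" where
  "periodic_mesh a l h Th \<longleftrightarrow>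
     triangulation Th \<and>
     (\<forall>K\<in>Th. int CARD('d) simplex K) \<and>
     \<Union>Th = cube a l \<and>
     h = Max (diameter ` Th) \<and>
     (\<forall>K\<in>Th. \<forall>K'\<in>Th. \<forall>z. (\<forall>i. z $ i \<in> \<int>) \<longrightarrow>
        (K \<inter> ((+) (l *\<^sub>R z)) ` K') face_of K \<and>
        (K \<inter> ((+) (l *\<^sub>R z)) ` K') face_of (((+) (l *\<^sub>R z)) ` K'))"

definition fe_space :: "real \<Rightarrow> (real ^ 'd) set set \<Rightarrow> (real ^ 'd \<Rightarrow> real) set" where
  "fe_space l Th = {u. continuous_on UNIV u \<and> periodic l u \<and>
     (\<forall>K\<in>Th. \<exists>g c. \<forall>x\<in>K. u x = g \<bullet> x + c)}"

text \<open>For finite element functions the gradient exists off the boundaries of the simplices, a null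
  set. The value chosen on that null set is irrelevant, since gradients only occur under
  integrals for the (complete) Lebesgue measure.\<close>

definition grad :: "(real ^ 'd \<Rightarrow> real) \<Rightarrow> real ^ 'd \<Rightarrow> real ^ 'd" where
  "grad u x = (THE D. GDERIV u x :> D)"

definition pairing ::
    "(real ^ 'd) set \<Rightarrow> (real ^ 'd \<Rightarrow> 'b::real_inner) \<Rightarrow> (real ^ 'd \<Rightarrow> 'b) \<Rightarrow> real" where
  "pairing \<Omega> u v = (LINT x:\<Omega>|lebesgue. u x \<bullet> v x)"

subsection \<open>Functions of time\<close>

definition tgrid :: "real \<Rightarrow> nat \<Rightarrow> real" where
  "tgrid \<tau> n = real n * \<tau>"

text \<open>Continuous piecewise linear functions: since the subintervals are closed, the pieces agree
  at the grid points, which is continuity in time.\<close>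

definition Pi1c :: "real \<Rightarrow> nat \<Rightarrow> ('x \<Rightarrow> real) set \<Rightarrow> (real \<Rightarrow> 'x \<Rightarrow> real) set" where
  "Pi1c \<tau> N X = {u. (\<forall>t\<in>{0..tgrid \<tau> N}. u t \<in> X) \<and>
     (\<forall>n<N. \<exists>p q. \<forall>t\<in>{tgrid \<tau> n..tgrid \<tau> (Suc n)}. \<forall>x. u t x = p x + t * q x)}"

text \<open>Piecewise constant functions, constant on each half-open subinterval that contains its right
  end point, so that the value on the new time interval is the value at its end.\<close>

definition Pi0 :: "real \<Rightarrow> nat \<Rightarrow> ('x \<Rightarrow> real) set \<Rightarrow> (real \<Rightarrow> 'x \<Rightarrow> real) set" where
  "Pi0 \<tau> N X = {u. (\<forall>t\<in>{0..tgrid \<tau> N}. u t \<in> X) \<and>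
     (\<forall>n<N. \<forall>t\<in>{tgrid \<tau> n<..tgrid \<tau> (Suc n)}. u t = u (tgrid \<tau> (Suc n)))}"

definition dtau :: "real \<Rightarrow> nat \<Rightarrow> (real \<Rightarrow> 'x \<Rightarrow> real) \<Rightarrow> 'x \<Rightarrow> real" where
  "dtau \<tau> n g x = (g (tgrid \<tau> (Suc n)) x - g (tgrid \<tau> n) x) / \<tau>"

subsection \<open>Potentials and coefficients\<close>

definition d1 :: "(real \<Rightarrow> real \<Rightarrow> real) \<Rightarrow> real \<Rightarrow> real \<Rightarrow> real" where
  "d1 f p t = deriv (\<lambda>q. f q t) p"

definition d2 :: "(real \<Rightarrow> real \<Rightarrow> real) \<Rightarrow> real \<Rightarrow> real \<Rightarrow> real" where
  "d2 f p t = deriv (\<lambda>r. f p r) t"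

text \<open>Continuous differentiability of order k; meant for open sets only.\<close>

primrec Ck_on :: "nat \<Rightarrow> (real \<times> real) set \<Rightarrow> (real \<Rightarrow> real \<Rightarrow> real) \<Rightarrow> bool" where
  "Ck_on 0 S f \<longleftrightarrow> continuous_on S (\<lambda>(p, t). f p t)"
| "Ck_on (Suc k) S f \<longleftrightarrow>
     (\<lambda>(p, t). f p t) differentiable_on S \<and> Ck_on k S (d1 f) \<and> Ck_on k S (d2 f)"

definition smooth_on :: "(real \<times> real) set \<Rightarrow> (real \<Rightarrow> real \<Rightarrow> real) \<Rightarrow> bool" where
  "smooth_on S f \<longleftrightarrow> (\<forall>k. Ck_on k S f)"

text \<open>Minimal regularity that makes the integrals involving a coefficient matrix meaningful; every
  continuous coefficient has it.\<close>

definition admissible_coeff ::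
    "(real \<Rightarrow> real ^ 'd \<Rightarrow> real \<Rightarrow> real ^ 'd ^ 'd) \<Rightarrow> bool" where
  "admissible_coeff X \<longleftrightarrow>
     (\<lambda>(p, g, t). X p g t) \<in> borel_measurable (restrict_space borel (UNIV \<times> UNIV \<times> {0<..})) \<and>
     (\<forall>S. compact S \<and> S \<subseteq> UNIV \<times> UNIV \<times> {0<..} \<longrightarrow> bounded ((\<lambda>(p, g, t). X p g t) ` S))"

definition block_vec :: "real ^ 'd \<Rightarrow> real ^ 'd \<Rightarrow> real ^ ('d + 'd)" where
  "block_vec u v = (\<chi> i. case i of Inl j \<Rightarrow> u $ j | Inr j \<Rightarrow> v $ j)"

definition block_L ::
    "real ^ 'd ^ 'd \<Rightarrow> real ^ 'd ^ 'd \<Rightarrow> real ^ 'd ^ 'd \<Rightarrow> real ^ ('d + 'd) ^ ('d + 'd)" where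
  "block_L K C M = (\<chi> i. case i of
      Inl j \<Rightarrow> block_vec (K $ j) (- (C $ j))
    | Inr j \<Rightarrow> block_vec (- (C $ j)) (M $ j))"

definition entropy_density ::
    "real \<Rightarrow> (real \<Rightarrow> real \<Rightarrow> real) \<Rightarrow> real \<Rightarrow> real ^ 'd \<Rightarrow> real \<Rightarrow> real" where
  "entropy_density \<gamma> f p g t = - (\<gamma> / 2) * (norm g)\<^sup>2 - d2 f p t"

definition energy_density :: "(real \<Rightarrow> real \<Rightarrow> real) \<Rightarrow> real \<Rightarrow> real \<Rightarrow> real" where
  "energy_density f p t = f p t - t * d2 f p t"

definition discrete_entropy ::
    "real \<Rightarrow> (real \<Rightarrow> real \<Rightarrow> real) \<Rightarrow> (real \<Rightarrow> real ^ 'd \<Rightarrow> real) \<Rightarrow> (real \<Rightarrow> real ^ 'd \<Rightarrow> real) \<Rightarrow>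
     real \<Rightarrow> real ^ 'd \<Rightarrow> real" where
  "discrete_entropy \<gamma> f \<phi> \<theta> t x = entropy_density \<gamma> f (\<phi> t x) (grad (\<phi> t) x) (\<theta> t x)"

definition discrete_energy ::
    "(real \<Rightarrow> real \<Rightarrow> real) \<Rightarrow> (real \<Rightarrow> real ^ 'd \<Rightarrow> real) \<Rightarrow> (real \<Rightarrow> real ^ 'd \<Rightarrow> real) \<Rightarrow>
     real \<Rightarrow> real ^ 'd \<Rightarrow> real" where
  "discrete_energy f \<phi> \<theta> t x = energy_density f (\<phi> t x) (\<theta> t x)"

definition f_phi ::
    "(real \<Rightarrow> real \<Rightarrow> real) \<Rightarrow> (real \<Rightarrow> real \<Rightarrow> real) \<Rightarrow> real \<Rightarrow> real \<Rightarrow> real \<Rightarrow> real" where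
  "f_phi fvex fcav p1 p0 t = d1 fvex p1 t + d1 fcav p0 t"

text \<open>The coefficient at the intermediate time s.\<close>

definition coeff_at ::
    "(real \<Rightarrow> real ^ 'd \<Rightarrow> real \<Rightarrow> real ^ 'd ^ 'd) \<Rightarrow> (real \<Rightarrow> real ^ 'd \<Rightarrow> real) \<Rightarrow>
     (real \<Rightarrow> real ^ 'd \<Rightarrow> real) \<Rightarrow> real \<Rightarrow> real ^ 'd \<Rightarrow> real ^ 'd ^ 'd" where
  "coeff_at X \<phi> \<theta> s x = X (\<phi> s x) (grad (\<phi> s) x) (\<theta> s x)"

subsection \<open>The scheme\<close>

text \<open>In the three equations, s is the intermediate time and t1 the new time level.\<close>

definition phase_equation where
  "phase_equation \<Omega> V \<tau> s M C \<phi> \<mu> \<theta> n \<longleftrightarrow> (\<forall>\<psi>\<in>V.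
    (let t1 = tgrid \<tau> (Suc n); Ms = coeff_at M \<phi> \<theta> s; Cs = coeff_at C \<phi> \<theta> s in
      pairing \<Omega> (dtau \<tau> n \<phi>) \<psi> =
      pairing \<Omega>
        (\<lambda>x. (\<mu> s x / \<theta> s x) *\<^sub>R (Ms x *v grad (\<theta> t1) x) - Ms x *v grad (\<mu> t1) x
             - (1 / \<theta> s x) *\<^sub>R (Cs x *v grad (\<theta> t1) x))
        (\<lambda>x. (1 / \<theta> t1 x) *\<^sub>R grad \<psi> x)))"

definition potential_equation where
  "potential_equation \<Omega> V \<tau> s \<gamma> fvex fcav \<phi> \<mu> \<theta> n \<longleftrightarrow> (\<forall>\<xi>\<in>V.
    (let t0 = tgrid \<tau> n; t1 = tgrid \<tau> (Suc n) in
      pairing \<Omega> (\<mu> t1) \<xi> =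
      \<gamma> * pairing \<Omega> (grad (\<phi> t1)) (\<lambda>x. \<theta> t1 x *\<^sub>R grad \<xi> x)
      + \<gamma> * pairing \<Omega> (grad (\<phi> s)) (\<lambda>x. \<xi> x *\<^sub>R grad (\<theta> t1) x)
      + pairing \<Omega> (\<lambda>x. f_phi fvex fcav (\<phi> t1 x) (\<phi> t0 x) (\<theta> t1 x)) \<xi>))"

definition entropy_equation where
  "entropy_equation \<Omega> V \<tau> s \<gamma> M K C f \<phi> \<mu> \<theta> n \<longleftrightarrow> (\<forall>\<omega>\<in>V.
    (let t1 = tgrid \<tau> (Suc n);
         Ms = coeff_at M \<phi> \<theta> s; Ks = coeff_at K \<phi> \<theta> s; Cs = coeff_at C \<phi> \<theta> s in
      pairing \<Omega> (dtau \<tau> n (discrete_entropy \<gamma> f \<phi> \<theta>)) \<omega> =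
      pairing \<Omega>
        (\<lambda>x. (1 / \<theta> s x) *\<^sub>R (Ks x *v grad (\<theta> t1) x) + Cs x *v grad (\<mu> t1) x
             - (2 * (\<mu> s x / \<theta> s x)) *\<^sub>R (Cs x *v grad (\<theta> t1) x)
             - \<mu> s x *\<^sub>R (Ms x *v grad (\<mu> t1) x)
             + ((\<mu> s x)\<^sup>2 / \<theta> s x) *\<^sub>R (Ms x *v grad (\<theta> t1) x))
        (\<lambda>x. (\<omega> x / ((\<theta> t1 x)\<^sup>2 * \<theta> s x)) *\<^sub>R grad (\<theta> t1) x
             - (1 / (\<theta> s x * \<theta> t1 x)) *\<^sub>R grad \<omega> x)
      + pairing \<Omega>
        (\<lambda>x. (1 / \<theta> s x) *\<^sub>R (Cs x *v grad (\<theta> t1) x) + Ms x *v grad (\<mu> t1) x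
             - (\<mu> s x / \<theta> s x) *\<^sub>R (Ms x *v grad (\<theta> t1) x))
        (\<lambda>x. (\<omega> x / (\<theta> t1 x)\<^sup>2) *\<^sub>R grad (\<mu> t1) x)
      + \<gamma> * pairing \<Omega> (grad (\<phi> s)) (\<lambda>x. dtau \<tau> n \<phi> x *\<^sub>R grad \<omega> x)))"

text \<open>The intermediate time of step n is \<open>tstar n\<close>.\<close>

definition discrete_solution where
  "discrete_solution \<Omega> V \<tau> N tstar \<gamma> M K C f fvex fcav \<phi>0 \<theta>0 \<phi> \<mu> \<theta> \<longleftrightarrow>
     \<phi> \<in> Pi1c \<tau> N V \<and> \<theta> \<in> Pi1c \<tau> N V \<and> \<mu> \<in> Pi0 \<tau> N V \<and>
     \<phi> 0 = \<phi>0 \<and> \<theta> 0 = \<theta>0 \<and>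
     (\<forall>n<N. phase_equation \<Omega> V \<tau> (tstar n) M C \<phi> \<mu> \<theta> n \<and>
            potential_equation \<Omega> V \<tau> (tstar n) \<gamma> fvex fcav \<phi> \<mu> \<theta> n \<and>
            entropy_equation \<Omega> V \<tau> (tstar n) \<gamma> M K C f \<phi> \<mu> \<theta> n)"

subsection \<open>Entropy production and numerical dissipation\<close>

definition entropy_production where
  "entropy_production \<Omega> \<tau> s M K C \<phi> \<mu> \<theta> n =
    (let t1 = tgrid \<tau> (Suc n);
         r = (\<lambda>x. block_vec
           ((1 / (\<theta> t1 x * \<theta> s x)) *\<^sub>R grad (\<theta> t1) x)
           ((\<mu> s x / (\<theta> t1 x * \<theta> s x)) *\<^sub>R grad (\<theta> t1) x - (1 / \<theta> t1 x) *\<^sub>R grad (\<mu> t1) x));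
         L = (\<lambda>x. block_L (coeff_at K \<phi> \<theta> s x) (coeff_at C \<phi> \<theta> s x) (coeff_at M \<phi> \<theta> s x))
     in LINT x:\<Omega>|lebesgue. r x \<bullet> (L x *v r x))"

text \<open>An intermediate value of the second-order Taylor expansion of g about a, evaluated at b.\<close>

definition taylor_point :: "(real \<Rightarrow> real) \<Rightarrow> real \<Rightarrow> real \<Rightarrow> real \<Rightarrow> bool" where
  "taylor_point g a b z \<longleftrightarrow>
     z \<in> closed_segment a b \<and>
     g b = g a + deriv g a * (b - a) + deriv (deriv g) z / 2 * (b - a)\<^sup>2"

text \<open>The convex part is expanded about the new phase field value and the concave part about the
  old one, matching the points at which \<open>f_phi\<close> evaluates their derivatives.\<close>

definition taylor_values where
  "taylor_values \<Omega> \<tau> f fvex fcav \<phi> \<theta> n \<zeta>1 \<zeta>2 \<zeta>3 \<longleftrightarrow>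
    (let t0 = tgrid \<tau> n; t1 = tgrid \<tau> (Suc n) in
     \<forall>x\<in>\<Omega>. taylor_point (\<lambda>r. f (\<phi> t0 x) r) (\<theta> t0 x) (\<theta> t1 x) (\<zeta>1 x) \<and>
             taylor_point (\<lambda>q. fvex q (\<theta> t1 x)) (\<phi> t1 x) (\<phi> t0 x) (\<zeta>2 x) \<and>
             taylor_point (\<lambda>q. fcav q (\<theta> t1 x)) (\<phi> t0 x) (\<phi> t1 x) (\<zeta>3 x))"

definition numerical_dissipation where
  "numerical_dissipation \<Omega> \<tau> \<gamma> f fvex fcav \<phi> \<theta> n \<zeta>1 \<zeta>2 \<zeta>3 =
    (let t0 = tgrid \<tau> n; t1 = tgrid \<tau> (Suc n) in
     - (\<tau> / 2) *
       (\<gamma> * pairing \<Omega> (\<lambda>x. (norm (grad (dtau \<tau> n \<phi>) x))\<^sup>2) (\<theta> t1)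
        - pairing \<Omega> (\<lambda>x. d2 (d2 f) (\<phi> t0 x) (\<zeta>1 x)) (\<lambda>x. (dtau \<tau> n \<theta> x)\<^sup>2)
        + pairing \<Omega> (\<lambda>x. d1 (d1 fvex) (\<zeta>2 x) (\<theta> t1 x) - d1 (d1 fcav) (\<zeta>3 x) (\<theta> t1 x))
            (\<lambda>x. (dtau \<tau> n \<phi> x)\<^sup>2)))"

end

theory Submission
  imports Defs
begin

text \<open>Testing the phase equation with 1 gives mass conservation, and testing the entropy equation with
  1 turns the fluxes into the quadratic form of L. For the energy, the entropy equation is tested
  with the new temperature, the phase equation with the new chemical potential and the potential
  equation with the discrete time derivative of the phase field: all fluxes and the intermediate
  gradient term cancel. What remains is matched pointwise with the increment of the energy density
  by the Taylor expansions and by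
  \<open>|g1|\<^sup>2 - |g0|\<^sup>2 = 2 g1 \<bullet> (g1 - g0) - |g1 - g0|\<^sup>2\<close>.\<close>

subsection \<open>Cellwise bounded functions\<close>

text \<open>The obstacle is integrability rather than algebra. The integral of a non-integrable
  function is 0 by convention, so a pointwise identity can be integrated term by term only once each
  term is known to be integrable. Gradients jump across cells, coefficients are merely Borel and
  locally bounded, and Taylor points are arbitrary choices; boundedness on each open cell is a
  property that all integrands share. The pointwise energy identity follows the path (phi0, theta0),
  (phi0, theta1), (phi1, theta1). On the first leg, the expansion about theta0 combines with the
  increment of the product of temperature and temperature derivative: besides the remainder there is
  left minus theta1 times the increment of the temperature derivative of \<open>f\<close>, the
  thermal part of the entropy increment tested with theta1. On the second leg, the expansion points
  of the convex and the concave part are those for which the first-order terms add up to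
  \<open>f_phi\<close> and both remainders have the dissipative sign.\<close>

text \<open>Only cell interiors are constrained: there gradients of finite element functions are
  constant, and the cell boundaries form a null set.\<close>

definition cellwise_bounded ::
    "'a::euclidean_space set set \<Rightarrow> ('a \<Rightarrow> 'b::real_normed_vector) \<Rightarrow> bool" where
  "cellwise_bounded Th f \<longleftrightarrow>
     (\<forall>K\<in>Th. \<exists>F\<in>borel_measurable borel. bounded (F ` interior K) \<and> (\<forall>x\<in>interior K. f x = F x))"

lemma cellwise_bounded_cong:
  assumes "cellwise_bounded Th g" "\<And>x. x \<in> \<Union>Th \<Longrightarrow> f x = g x"
  shows "cellwise_bounded Th f"
  unfolding cellwise_bounded_def
proof
  fix K assume K: "K \<in> Th"
  then obtain F where "F \<in> borel_measurable borel" "bounded (F ` interior K)"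
      "\<forall>x\<in>interior K. g x = F x"
    using assms(1) unfolding cellwise_bounded_def by blast
  moreover have "f x = g x" if "x \<in> interior K" for x
    using assms(2) K that interior_subset by blast
  ultimately show "\<exists>F\<in>borel_measurable borel. bounded (F ` interior K) \<and> (\<forall>x\<in>interior K. f x = F x)"
    by (intro bexI[of _ F]) auto
qed

lemma cellwise_bounded_continuous:
  assumes "\<And>K. K \<in> Th \<Longrightarrow> compact K" "continuous_on UNIV f"
  shows "cellwise_bounded Th f"
  unfolding cellwise_bounded_def
proof
  fix K assume "K \<in> Th"
  then have "compact (f ` K)"
    using assms continuous_on_subset compact_continuous_image by blast
  then have "bounded (f ` interior K)"
    by (meson bounded_subset compact_imp_bounded image_mono interior_subset)
  then show "\<exists>F\<in>borel_measurable borel. bounded (F ` interior K) \<and> (\<forall>x\<in>interior K. f x = F x)"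
    using borel_measurable_continuous_onI[OF assms(2)] by blast
qed

text \<open>One closure property serves scaling, products, inner products and matrix-vector
  products. Second countability makes pairs of Borel functions Borel, and \<open>H\<close> is
  continuous on pairs.\<close>

lemma cellwise_bounded_bilinear:
  fixes f :: "'a::euclidean_space \<Rightarrow> 'b::{real_normed_vector, second_countable_topology}"
    and g :: "'a \<Rightarrow> 'c::{real_normed_vector, second_countable_topology}"
  assumes "bounded_bilinear H" "cellwise_bounded Th f" "cellwise_bounded Th g"
  shows "cellwise_bounded Th (\<lambda>x. H (f x) (g x))"
  unfolding cellwise_bounded_def
proof
  fix K assume K: "K \<in> Th"
  obtain F G where F: "F \<in> borel_measurable borel" "bounded (F ` interior K)"
      "\<forall>x\<in>interior K. f x = F x"
    and G: "G \<in> borel_measurable borel" "bounded (G ` interior K)" "\<forall>x\<in>interior K. g x = G x"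
    using assms K unfolding cellwise_bounded_def by blast
  obtain B where B: "\<And>x. x \<in> interior K \<Longrightarrow> norm (F x) \<le> B"
    using F(2) unfolding bounded_iff by auto
  obtain B' where B': "\<And>x. x \<in> interior K \<Longrightarrow> norm (G x) \<le> B'"
    using G(2) unfolding bounded_iff by auto
  obtain k where k: "k > 0" "\<And>a b. norm (H a b) \<le> norm a * norm b * k"
    using bounded_bilinear.pos_bounded[OF assms(1)] by blast
  have "norm (H (F x) (G x)) \<le> B * B' * k" if "x \<in> interior K" for x
  proof -
    \<comment> \<open>Monotonicity needs \<open>B\<close> to be nonnegative, which follows from the
      bound at the point x itself; an empty interior would give no such information.\<close>
    have "norm (F x) * norm (G x) * k \<le> B * B' * k"
      using B[OF that] B'[OF that] k(1) norm_ge_zero[of "F x"] norm_ge_zero[of "G x"]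
      by (intro mult_right_mono mult_mono) linarith+
    then show ?thesis using k(2) order_trans by blast
  qed
  then have "bounded ((\<lambda>x. H (F x) (G x)) ` interior K)"
    unfolding bounded_iff by blast
  moreover have "(\<lambda>x. H (F x) (G x)) \<in> borel_measurable borel"
    by (rule borel_measurable_continuous_Pair[OF F(1) G(1)])
      (rule bounded_bilinear.continuous_on[OF assms(1)
          continuous_on_fst[OF continuous_on_id] continuous_on_snd[OF continuous_on_id]])
  ultimately show "\<exists>F\<in>borel_measurable borel. bounded (F ` interior K) \<and>
      (\<forall>x\<in>interior K. H (f x) (g x) = F x)"
    using F(3) G(3) by (intro bexI[of _ "\<lambda>x. H (F x) (G x)"]) auto
qed

lemma cellwise_bounded_add:
  fixes f g :: "'a::euclidean_space \<Rightarrow> 'b::{real_normed_vector, second_countable_topology}"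
  assumes "cellwise_bounded Th f" "cellwise_bounded Th g"
  shows "cellwise_bounded Th (\<lambda>x. f x + g x)"
  unfolding cellwise_bounded_def
proof
  fix K assume K: "K \<in> Th"
  obtain F G where F: "F \<in> borel_measurable borel" "bounded (F ` interior K)"
      "\<forall>x\<in>interior K. f x = F x"
    and G: "G \<in> borel_measurable borel" "bounded (G ` interior K)" "\<forall>x\<in>interior K. g x = G x"
    using assms K unfolding cellwise_bounded_def by blast
  show "\<exists>F\<in>borel_measurable borel. bounded (F ` interior K) \<and>
      (\<forall>x\<in>interior K. f x + g x = F x)"
    using F G by (intro bexI[of _ "\<lambda>x. F x + G x"]) (auto intro: bounded_plus_comp)
qed

lemmas cellwise_bounded_scaleR = cellwise_bounded_bilinear[OF bounded_bilinear_scaleR]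
lemmas cellwise_bounded_mult = cellwise_bounded_bilinear[OF bounded_bilinear_mult]
lemmas cellwise_bounded_inner = cellwise_bounded_bilinear[OF bounded_bilinear_inner]

lemma cellwise_bounded_diff:
  fixes f g :: "'a::euclidean_space \<Rightarrow> 'b::{real_normed_vector, second_countable_topology}"
  assumes "\<And>K. K \<in> Th \<Longrightarrow> compact K" "cellwise_bounded Th f" "cellwise_bounded Th g"
  shows "cellwise_bounded Th (\<lambda>x. f x - g x)"
proof -
  have "cellwise_bounded Th (\<lambda>x. f x + (-1) *\<^sub>R g x)"
    by (intro cellwise_bounded_add cellwise_bounded_scaleR cellwise_bounded_continuous assms
        continuous_intros)
  then show ?thesis by simp
qed

lemma bounded_bilinear_matrix_vector_mult:
  "bounded_bilinear ((*v) :: real ^ 'n ^ 'm \<Rightarrow> real ^ 'n \<Rightarrow> real ^ 'm)"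
  unfolding bilinear_conv_bounded_bilinear[symmetric]
  by (auto simp: bilinear_def linear_iff matrix_vector_right_distrib matrix_vector_mult_scaleR
      matrix_vector_mult_add_rdistrib scaleR_matrix_vector_assoc)

lemmas cellwise_bounded_matrix_vector_mult =
  cellwise_bounded_bilinear[OF bounded_bilinear_matrix_vector_mult]

section \<open>Integration over the mesh up to null sets\<close>

lemma negligible_outside_interiors:
  assumes "finite Th" "\<And>K. K \<in> Th \<Longrightarrow> convex K"
  shows "negligible (\<Union>Th - \<Union>(interior ` Th))"
proof (rule negligible_subset)
  show "negligible (\<Union>(frontier ` Th))"
    using assms by (intro negligible_Union) (auto intro: negligible_convex_frontier)
  show "\<Union>Th - \<Union>(interior ` Th) \<subseteq> \<Union>(frontier ` Th)"
    using closure_subset unfolding frontier_def by blast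
qed

text \<open>A bounded Borel function is integrable on an open cell, which has finite measure.
  Finitely many cells are joined, and the cell boundaries are then added as a null set.\<close>

lemma cellwise_bounded_integrable:
  fixes f :: "'a::euclidean_space \<Rightarrow> real"
  assumes Th: "finite Th" "\<And>K. K \<in> Th \<Longrightarrow> convex K" "\<And>K. K \<in> Th \<Longrightarrow> compact K"
    and f: "cellwise_bounded Th f"
  shows "f absolutely_integrable_on \<Union>Th"
proof (rule absolutely_integrable_spike_set)
  have "f absolutely_integrable_on interior K" if K: "K \<in> Th" for K
  proof -
    obtain F where F: "F \<in> borel_measurable borel" "\<And>x. x \<in> interior K \<Longrightarrow> f x = F x"
      and "bounded (F ` interior K)"
      using f K unfolding cellwise_bounded_def by blast
    then obtain B where B: "\<And>x. x \<in> interior K \<Longrightarrow> norm (F x) \<le> B"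
      unfolding bounded_iff by auto
    have "emeasure lborel (interior K) < \<infinity>"
      using K Th(3) by (intro emeasure_bounded_finite bounded_interior compact_imp_bounded)
    then have "set_integrable lebesgue (interior K) F"
      unfolding set_integrable_def using F B
      by (intro integrableI_bounded_set_indicator[where B = B])
        (auto intro: measurable_completion)
    then show ?thesis
      by (subst set_integrable_cong[OF refl refl, of _ _ F]) (auto simp: F)
  qed
  then show "f absolutely_integrable_on (\<Union>K\<in>Th. interior K)"
    by (intro set_integrable_UN Th) auto
  show "negligible {x \<in> \<Union>(interior ` Th) - \<Union>Th. f x \<noteq> 0}"
    using interior_subset by (intro negligible_subset[OF negligible_empty]) blast
  show "negligible {x \<in> \<Union>Th - \<Union>(interior ` Th). f x \<noteq> 0}"
    using negligible_outside_interiors[OF Th(1,2)] by (rule negligible_subset) auto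
qed

text \<open>Integrability of \<open>g\<close> is inherited from \<open>f\<close>. This serves
  identities that involve \<open>grad\<close> and therefore hold only off the cell
  boundaries.\<close>

lemma set_lebesgue_integral_spike:
  fixes f g :: "'a::euclidean_space \<Rightarrow> real"
  assumes "f absolutely_integrable_on S" "negligible N" "\<And>x. x \<in> S - N \<Longrightarrow> g x = f x"
  shows "(LINT x:S|lebesgue. g x) = (LINT x:S|lebesgue. f x)"
proof -
  have "g absolutely_integrable_on S"
    using assms by (rule absolutely_integrable_spike)
  then show ?thesis
    using assms integral_spike[OF assms(2,3)] by (simp add: set_lebesgue_integral_eq_integral(2))
qed

subsection \<open>Finite element functions\<close>

lemma grad_eqI:
  assumes "GDERIV u x :> D"
  shows "grad u x = D"
  unfolding grad_def
proof (rule the_equality)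
  show "GDERIV u x :> D" by (rule assms)
  fix E assume "GDERIV u x :> E"
  then have "(\<lambda>h. h \<bullet> E) = (\<lambda>h. h \<bullet> D)"
    using assms has_derivative_unique unfolding gderiv_def by blast
  then show "E = D"
    by (metis vector_eq_ldot)
qed

lemma grad_const [simp]: "grad (\<lambda>x. c) x = 0"
  by (rule grad_eqI) (rule GDERIV_const)

lemma grad_affine:
  assumes "\<And>y. y \<in> S \<Longrightarrow> u y = g \<bullet> y + c" "x \<in> interior S"
  shows "grad u x = g"
proof (rule grad_eqI, unfold gderiv_def, rule has_derivative_transform_within_open)
  show "((\<lambda>y. g \<bullet> y + c) has_derivative (\<lambda>h. h \<bullet> g)) (at x)"
    by (auto intro!: derivative_eq_intros simp: inner_commute)
  show "\<And>y. y \<in> interior S \<Longrightarrow> g \<bullet> y + c = u y"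
    using assms(1) interior_subset by fastforce
qed (use assms in auto)

text \<open>Inside a cell all three functions are affine and their gradients can be read off. At a
  kink \<open>grad\<close> is an unspecified value, and linearity cannot be expected.\<close>

lemma grad_diff_quotient:
  assumes u: "u \<in> fe_space l Th" and v: "v \<in> fe_space l Th" and K: "K \<in> Th" "x \<in> interior K"
  shows "grad (\<lambda>y. (u y - v y) / \<tau>) x = (1 / \<tau>) *\<^sub>R (grad u x - grad v x)"
proof -
  obtain g c where g: "\<And>y. y \<in> K \<Longrightarrow> u y = g \<bullet> y + c"
    using u K(1) unfolding fe_space_def by blast
  obtain g' c' where g': "\<And>y. y \<in> K \<Longrightarrow> v y = g' \<bullet> y + c'"
    using v K(1) unfolding fe_space_def by blast
  have "(u y - v y) / \<tau> = ((1 / \<tau>) *\<^sub>R (g - g')) \<bullet> y + (c - c') / \<tau>" if "y \<in> K" for y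
    using g[OF that] g'[OF that] by (simp add: inner_diff_left field_simps diff_divide_distrib
        add_divide_distrib)
  then have "grad (\<lambda>y. (u y - v y) / \<tau>) x = (1 / \<tau>) *\<^sub>R (g - g')"
    using K(2) by (rule grad_affine)
  moreover have "grad u x = g" "grad v x = g'"
    using K(2) g g' by (auto intro: grad_affine)
  ultimately show ?thesis by simp
qed

lemma fe_space_const: "(\<lambda>x. c) \<in> fe_space l Th"
  unfolding fe_space_def periodic_def by (auto intro: exI[of _ 0])

text \<open>Makes the discrete time derivative of the phase field an admissible test
  function.\<close>

lemma fe_space_diff_quotient:
  assumes u: "u \<in> fe_space l Th" and v: "v \<in> fe_space l Th"
  shows "(\<lambda>x. (u x - v x) / \<tau>) \<in> fe_space l Th"
  unfolding fe_space_def
proof (intro CollectI conjI ballI)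
  show "continuous_on UNIV (\<lambda>x. (u x - v x) / \<tau>)"
  proof (cases "\<tau> = 0")
    case False
    then show ?thesis
      using u v unfolding fe_space_def by (auto intro!: continuous_intros)
  qed simp
  show "periodic l (\<lambda>x. (u x - v x) / \<tau>)"
    using u v unfolding fe_space_def periodic_def by simp
  fix K assume K: "K \<in> Th"
  obtain g c where g: "\<And>y. y \<in> K \<Longrightarrow> u y = g \<bullet> y + c"
    using u K unfolding fe_space_def by blast
  obtain g' c' where g': "\<And>y. y \<in> K \<Longrightarrow> v y = g' \<bullet> y + c'"
    using v K unfolding fe_space_def by blast
  have "(u y - v y) / \<tau> = ((1 / \<tau>) *\<^sub>R (g - g')) \<bullet> y + (c - c') / \<tau>" if "y \<in> K" for y
    using g[OF that] g'[OF that] by (simp add: inner_diff_left field_simps diff_divide_distrib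
        add_divide_distrib)
  then show "\<exists>g c. \<forall>x\<in>K. (u x - v x) / \<tau> = g \<bullet> x + c"
    by blast
qed

lemma cellwise_bounded_grad:
  assumes "u \<in> fe_space l Th"
  shows "cellwise_bounded Th (grad u)"
  unfolding cellwise_bounded_def
proof
  fix K assume "K \<in> Th"
  then obtain g c where "\<And>y. y \<in> K \<Longrightarrow> u y = g \<bullet> y + c"
    using assms unfolding fe_space_def by blast
  then have "grad u x = g" if "x \<in> interior K" for x
    using grad_affine that by blast
  then show "\<exists>F\<in>borel_measurable borel. bounded (F ` interior K) \<and> (\<forall>x\<in>interior K. grad u x = F x)"
    by (intro bexI[of _ "\<lambda>x. g"]) (auto simp: bounded_iff)
qed

text \<open>Freezing the gradient at its constant value on the cell makes the argument of
  \<open>X\<close> a continuous function of x. It maps the compact cell to a compact set of positive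
  temperatures, where \<open>X\<close> is bounded.\<close>

lemma cellwise_bounded_coeff:
  fixes X :: "real \<Rightarrow> real ^ 'd \<Rightarrow> real \<Rightarrow> real ^ 'd ^ 'd"
  assumes X: "admissible_coeff X" and Th: "\<And>K. K \<in> Th \<Longrightarrow> compact K"
    and p: "\<phi> s \<in> fe_space l Th" and t: "continuous_on UNIV (\<theta> s)" "\<And>x. \<theta> s x > 0"
  shows "cellwise_bounded Th (coeff_at X \<phi> \<theta> s)"
  unfolding cellwise_bounded_def
proof
  fix K assume K: "K \<in> Th"
  then obtain g c where "\<And>y. y \<in> K \<Longrightarrow> \<phi> s y = g \<bullet> y + c"
    using p unfolding fe_space_def by blast
  then have g: "grad (\<phi> s) x = g" if "x \<in> interior K" for x
    using grad_affine that by blast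
  define h where "h = (\<lambda>x. (\<phi> s x, g, \<theta> s x))"
  define Y where "Y = (\<lambda>(p, g, t). X p g t)"
  have h: "continuous_on UNIV h"
    using p t unfolding h_def fe_space_def by (auto intro!: continuous_intros)
  have pos: "h ` A \<subseteq> UNIV \<times> UNIV \<times> {0<..}" for A
    using t(2) unfolding h_def by auto
  have "Y \<in> borel_measurable (restrict_space borel (UNIV \<times> UNIV \<times> {0<..}))"
    using X unfolding admissible_coeff_def Y_def by blast
  moreover have "h \<in> measurable borel (restrict_space borel (UNIV \<times> UNIV \<times> {0<..}))"
    using borel_measurable_continuous_onI[OF h] pos[of UNIV]
    by (intro measurable_restrict_space2) auto
  ultimately have "(\<lambda>x. Y (h x)) \<in> borel_measurable borel"
    by (rule measurable_compose[rotated])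
  moreover have "bounded ((\<lambda>x. Y (h x)) ` interior K)"
  proof (rule bounded_subset)
    have "compact (h ` K)"
      using K Th h continuous_on_subset compact_continuous_image by blast
    then show "bounded (Y ` h ` K)"
      using X pos[of K] unfolding admissible_coeff_def Y_def by blast
    show "(\<lambda>x. Y (h x)) ` interior K \<subseteq> Y ` h ` K"
      using interior_subset by blast
  qed
  ultimately show "\<exists>F\<in>borel_measurable borel. bounded (F ` interior K) \<and>
      (\<forall>x\<in>interior K. coeff_at X \<phi> \<theta> s x = F x)"
    by (intro bexI[of _ "\<lambda>x. Y (h x)"]) (auto simp: coeff_at_def Y_def h_def g)
qed

subsection \<open>Differentiability and Taylor expansion of the potentials\<close>

text \<open>\<open>deriv\<close> is total; joint differentiability is what makes \<open>d1\<close>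
  and \<open>d2\<close> genuine partial derivatives.\<close>

lemma differentiable_partial:
  assumes "(\<lambda>(p, t). f p t) differentiable_on S" "open S" "(p, t) \<in> S"
  shows "((\<lambda>q. f q t) has_real_derivative d1 f p t) (at p)"
    and "((\<lambda>r. f p r) has_real_derivative d2 f p t) (at t)"
proof -
  have f: "(\<lambda>(p, t). f p t) differentiable at (p, t)"
    using assms by (auto simp: differentiable_on_eq_differentiable_at)
  have "(\<lambda>q. (\<lambda>(p, t). f p t) (q, t)) differentiable at p"
    by (rule differentiable_compose[of _ "\<lambda>q. (q, t)"])
      (use f in \<open>auto intro!: derivative_intros simp: differentiable_def\<close>)
  then show "((\<lambda>q. f q t) has_real_derivative d1 f p t) (at p)"
    by (simp add: d1_def DERIV_deriv_iff_real_differentiable)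
  have "(\<lambda>r. (\<lambda>(p, t). f p t) (p, r)) differentiable at t"
    by (rule differentiable_compose[of _ "\<lambda>r. (p, r)"])
      (use f in \<open>auto intro!: derivative_intros simp: differentiable_def\<close>)
  then show "((\<lambda>r. f p r) has_real_derivative d2 f p t) (at t)"
    by (simp add: d2_def DERIV_deriv_iff_real_differentiable)
qed

lemma Ck_on_2D:
  assumes "Ck_on 2 S f"
  shows "(\<lambda>(p, t). f p t) differentiable_on S" "(\<lambda>(p, t). d1 f p t) differentiable_on S"
    "(\<lambda>(p, t). d2 f p t) differentiable_on S"
  using assms by (simp_all add: numeral_2_eq_2)

lemma taylor_point_exists:
  assumes g: "\<And>x. x \<in> closed_segment a b \<Longrightarrow> (g has_real_derivative deriv g x) (at x)"
    "\<And>x. x \<in> closed_segment a b \<Longrightarrow> (deriv g has_real_derivative deriv (deriv g) x) (at x)"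
  shows "\<exists>z. taylor_point g a b z"
\<comment> \<open>The Lagrange remainder requires distinct points; for a = b the point itself
  serves.\<close>
proof (cases "a = b")
  case True
  then show ?thesis by (auto simp: taylor_point_def)
next
  case False
  \<comment> \<open>The library form of Taylor's theorem takes a sequence of derivatives. Orders up
    to 2 enter, so the later entries are filler.\<close>
  define diff where "diff m = (if m = 0 then g else if m = 1 then deriv g else deriv (deriv g))"
    for m :: nat
  have seg: "closed_segment a b = {min a b..max a b}"
    by (auto simp: closed_segment_eq_real_ivl)
  have "\<exists>t. (if b < a then b < t \<and> t < a else a < t \<and> t < b) \<and>
      g b = (\<Sum>m<2. diff m a / fact m * (b - a) ^ m) + diff 2 t / fact 2 * (b - a) ^ 2"
    using False g unfolding seg
    by (intro Taylor[where a = "min a b" and b = "max a b"]) (auto simp: diff_def less_2_cases_iff)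
  then obtain t where t: "if b < a then b < t \<and> t < a else a < t \<and> t < b"
    and eq: "g b = (\<Sum>m<2. diff m a / fact m * (b - a) ^ m) + diff 2 t / fact 2 * (b - a) ^ 2"
    by blast
  have "t \<in> closed_segment a b"
    using t unfolding seg by (auto split: if_splits)
  moreover have "g b = g a + deriv g a * (b - a) + deriv (deriv g) t / 2 * (b - a)\<^sup>2"
    using eq by (simp add: diff_def numeral_2_eq_2)
  ultimately show ?thesis
    unfolding taylor_point_def by blast
qed

text \<open>Adding the tangent inequalities at two points shows that \<open>g'\<close> is monotone,
  so its derivative is nonnegative.\<close>

lemma convex_on_deriv2_nonneg:
  fixes g :: "real \<Rightarrow> real"
  assumes convex: "convex_on A g" and A: "open A" "connected A" and x: "x \<in> A"
    and g: "\<And>x. x \<in> A \<Longrightarrow> (g has_real_derivative g' x) (at x)"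
    and g': "(g' has_real_derivative D) (at x)"
  shows "D \<ge> 0"
proof (rule mono_on_imp_deriv_nonneg[OF _ g'])
  show "mono_on A g'"
  proof (rule mono_onI)
    fix r s assume rs: "r \<in> A" "s \<in> A" "r \<le> s"
    have tangent: "g y - g c \<ge> g' c * (y - c)" if "c \<in> A" "y \<in> A" for c y
    proof (rule convex_on_imp_above_tangent[OF convex A(2)])
      show "c \<in> interior A" using A that by (simp add: interior_open)
    qed (use that g has_field_derivative_at_within in blast)+
    then have "g s - g r \<ge> g' r * (s - r)" "g r - g s \<ge> g' s * (r - s)"
      using rs by blast+
    then have "(g' s - g' r) * (s - r) \<ge> 0"
      by (simp add: algebra_simps)
    then show "g' r \<le> g' s"
      using rs by (cases "r = s") (auto simp: zero_le_mult_iff)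
  qed
  show "x \<in> interior A"
    using A x by (simp add: interior_open)
qed

lemma taylor_pointD2:
  assumes "taylor_point (\<lambda>r. f p r) a b z"
  shows "z \<in> closed_segment a b"
    and "f p b = f p a + d2 f p a * (b - a) + d2 (d2 f) p z / 2 * (b - a)\<^sup>2"
  using assms by (simp_all add: taylor_point_def d2_def[abs_def])

lemma taylor_pointD1:
  assumes "taylor_point (\<lambda>q. f q t) a b z"
  shows "f b t = f a t + d1 f a t * (b - a) + d1 (d1 f) z t / 2 * (b - a)\<^sup>2"
  using assms by (simp add: taylor_point_def d1_def[abs_def])

lemma open_half_plane: "open (UNIV \<times> {0<..} :: (real \<times> real) set)"
  by (intro open_Times) auto

lemma taylor_point_exists2:
  assumes "Ck_on 2 (UNIV \<times> {0<..}) f" "a > 0" "b > 0"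
  shows "\<exists>z. taylor_point (\<lambda>r. f p r) a b z"
proof (rule taylor_point_exists)
  fix x assume "x \<in> closed_segment a b"
  then have x: "(p, x) \<in> UNIV \<times> {0<..}"
    using assms(2,3) by (auto simp: closed_segment_eq_real_ivl split: if_splits)
  show "((\<lambda>r. f p r) has_real_derivative deriv (\<lambda>r. f p r) x) (at x)"
    using differentiable_partial(2)[OF Ck_on_2D(1)[OF assms(1)] open_half_plane x]
    by (simp add: d2_def)
  show "(deriv (\<lambda>r. f p r) has_real_derivative deriv (deriv (\<lambda>r. f p r)) x) (at x)"
    using differentiable_partial(2)[OF Ck_on_2D(3)[OF assms(1)] open_half_plane x]
    by (simp add: d2_def[abs_def])
qed

lemma taylor_point_exists1:
  assumes "Ck_on 2 (UNIV \<times> {0<..}) f" "t > 0"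
  shows "\<exists>z. taylor_point (\<lambda>q. f q t) a b z"
proof (rule taylor_point_exists)
  fix x :: real
  have x: "(x, t) \<in> UNIV \<times> {0<..}"
    using assms(2) by simp
  show "((\<lambda>q. f q t) has_real_derivative deriv (\<lambda>q. f q t) x) (at x)"
    using differentiable_partial(1)[OF Ck_on_2D(1)[OF assms(1)] open_half_plane x]
    by (simp add: d1_def)
  show "(deriv (\<lambda>q. f q t) has_real_derivative deriv (deriv (\<lambda>q. f q t)) x) (at x)"
    using differentiable_partial(1)[OF Ck_on_2D(2)[OF assms(1)] open_half_plane x]
    by (simp add: d1_def[abs_def])
qed

text \<open>With the two lemmas that follow, this gives the signs of the three second derivatives in
  the numerical dissipation.\<close>

lemma d1_d1_nonneg:
  assumes "Ck_on 2 (UNIV \<times> {0<..}) f" "t > 0" "convex_on UNIV (\<lambda>p. f p t)"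
  shows "d1 (d1 f) p t \<ge> 0"
  using assms
  by (intro convex_on_deriv2_nonneg[where A = UNIV and g = "\<lambda>p. f p t" and x = p])
    (auto intro!: differentiable_partial(1)[OF _ open_half_plane] Ck_on_2D)

lemma d1_d1_nonpos:
  assumes "Ck_on 2 (UNIV \<times> {0<..}) f" "t > 0" "concave_on UNIV (\<lambda>p. f p t)"
  shows "d1 (d1 f) p t \<le> 0"
proof -
  have "- d1 (d1 f) p t \<ge> 0"
    using assms
    by (intro convex_on_deriv2_nonneg[where A = UNIV and g = "\<lambda>p. - f p t" and x = p])
      (auto simp: concave_on_def
        intro!: derivative_intros differentiable_partial(1)[OF _ open_half_plane] Ck_on_2D)
  then show ?thesis by simp
qed

lemma d2_d2_nonpos:
  assumes "Ck_on 2 (UNIV \<times> {0<..}) f" "t > 0" "concave_on {0<..} (\<lambda>t. f p t)"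
  shows "d2 (d2 f) p t \<le> 0"
proof -
  have "- d2 (d2 f) p t \<ge> 0"
    using assms
    by (intro convex_on_deriv2_nonneg[where A = "{0<..}" and g = "\<lambda>t. - f p t" and x = t])
      (auto simp: concave_on_def
        intro!: derivative_intros differentiable_partial(2)[OF _ open_half_plane] Ck_on_2D)
  then show ?thesis by simp
qed

lemma continuous_on_potential:
  assumes "(\<lambda>(p, t). f p t) differentiable_on UNIV \<times> {0<..}"
    and "continuous_on S u" "continuous_on S v" "\<And>x. v x > 0"
  shows "continuous_on S (\<lambda>x. f (u x) (v x))"
proof -
  have "continuous_on S (\<lambda>x. (\<lambda>(p, t). f p t) (u x, v x))"
    using assms(2-4)
    by (intro continuous_on_compose2[OF differentiable_imp_continuous_on[OF assms(1)]]
        continuous_intros) auto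
  then show ?thesis by simp
qed

subsection \<open>The block quadratic form\<close>

lemma inner_block_vec: "block_vec u v \<bullet> block_vec w z = u \<bullet> w + v \<bullet> z"
  by (simp add: inner_vec_def block_vec_def UNIV_Plus_UNIV[symmetric] sum.Plus del: UNIV_Plus_UNIV)

lemma block_L_mult_block_vec:
  "block_L K C M *v block_vec u v = block_vec (K *v u - C *v v) (M *v v - C *v u)"
  by (simp add: vec_eq_iff block_L_def matrix_vector_mul_component inner_block_vec split: sum.split)
    (simp add: block_vec_def matrix_vector_mul_component split: sum.split)

text \<open>The flux tested with the constant function 1, regrouped as the quadratic form of L.\<close>

lemma entropy_production_density:
  fixes K C M :: "real ^ 'd ^ 'd"
  shows "((1 / ts) *\<^sub>R (K *v g) + C *v h - (2 * (m / ts)) *\<^sub>R (C *v g) - m *\<^sub>R (M *v h)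
           + (m\<^sup>2 / ts) *\<^sub>R (M *v g)) \<bullet> ((1 / (t\<^sup>2 * ts)) *\<^sub>R g)
        + ((1 / ts) *\<^sub>R (C *v g) + M *v h - (m / ts) *\<^sub>R (M *v g)) \<bullet> ((1 / t\<^sup>2) *\<^sub>R h)
     = (let r = block_vec ((1 / (t * ts)) *\<^sub>R g) ((m / (t * ts)) *\<^sub>R g - (1 / t) *\<^sub>R h)
        in r \<bullet> (block_L K C M *v r))"
  \<comment> \<open>The mixed terms g . Ch and h . Cg (likewise for M) arise once each on both
    sides, so they match separately, without any symmetry of the matrices.\<close>
  by (simp add: block_L_mult_block_vec inner_block_vec matrix_vector_mult_diff_distrib
      matrix_vector_mult_scaleR inner_diff_left inner_diff_right inner_add_left inner_add_right
      inner_commute[of "_ *v _"])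
    (simp add: divide_inverse power2_eq_square algebra_simps)

text \<open>Indices 0 and 1 refer to the old and the new time level; for \<open>f\<close> and \<open>e\<close>, its temperature
  derivative, the first index belongs to the phase field and the second to the temperature. The
  convex part \<open>v\<close>, the concave part \<open>c\<close> and their phase field derivatives \<open>w\<close>, \<open>d\<close> are taken at the
  new temperature; \<open>f2\<close>, \<open>v2\<close>, \<open>c2\<close> are second derivatives at the Taylor points.\<close>

lemma energy_identity:
  fixes g0 g1 :: "'a::real_inner"
  assumes "\<tau> \<noteq> 0"
    and f: "f01 = f00 + e00 * (t1 - t0) + f2 / 2 * (t1 - t0)\<^sup>2"
    and v: "v0 = v1 + w1 * (p0 - p1) + v2 / 2 * (p0 - p1)\<^sup>2"
    and c: "c1 = c0 + d0 * (p1 - p0) + c2 / 2 * (p1 - p0)\<^sup>2"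
    and split: "f01 = v0 + c0" "f11 = v1 + c1"
  shows "((f11 - t1 * e11) - (f00 - t0 * e00)) / \<tau> =
    (- (\<tau> / 2)) * (\<gamma> * ((norm ((1 / \<tau>) *\<^sub>R (g1 - g0)))\<^sup>2 * t1) - f2 * ((t1 - t0) / \<tau>)\<^sup>2
       + (v2 - c2) * ((p1 - p0) / \<tau>)\<^sup>2)
    + (((- (\<gamma> / 2) * (norm g1)\<^sup>2 - e11) - (- (\<gamma> / 2) * (norm g0)\<^sup>2 - e00)) / \<tau> * t1
       + \<gamma> * (g1 \<bullet> (t1 *\<^sub>R ((1 / \<tau>) *\<^sub>R (g1 - g0)))) + (w1 + d0) * ((p1 - p0) / \<tau>))"
proof -
  define P Q where "P = (p1 - p0) / \<tau>" and "Q = (t1 - t0) / \<tau>"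
  have p1: "p1 = p0 + \<tau> * P" and t1: "t1 = t0 + \<tau> * Q"
    using assms(1) by (simp_all add: P_def Q_def)
  \<comment> \<open>Both phase field expansions are solved for \<open>f11\<close>, and the
    temperature expansion for \<open>v0\<close>. On substitution \<open>c0\<close> cancels, which
    leaves \<open>f00\<close> as the only remaining value of the potential.\<close>
  have f11: "f11 = v0 - w1 * (p0 - p1) - v2 / 2 * (p0 - p1)\<^sup>2 + c0 + d0 * (p1 - p0)
      + c2 / 2 * (p1 - p0)\<^sup>2"
    using v c split by simp
  have v0: "v0 = f00 + e00 * (t1 - t0) + f2 / 2 * (t1 - t0)\<^sup>2 - c0"
    using f split by simp
  show ?thesis
    unfolding f11 v0 p1 t1 power2_norm_eq_inner using assms(1)
    by (simp add: inner_diff_left inner_diff_right inner_commute[of g0 g1])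
      (simp add: field_simps power2_eq_square)
qed

subsection \<open>One time step\<close>

lemma pairing_uminus_left: "pairing \<Omega> (\<lambda>x. - u x) v = - pairing \<Omega> u v"
  by (simp add: pairing_def set_lebesgue_integral_def)

text \<open>Collects what one time step rests on: finite element functions at the times
  \<open>t0\<close>, \<open>t1\<close> and \<open>s\<close>, finitely many compact convex cells, and
  semidefiniteness of L in place of the two-sided ellipticity bounds.\<close>

locale scheme_step =
  fixes Th :: "(real ^ 'd) set set" and l \<tau> s \<gamma> :: real and n :: nat
    and M K C :: "real \<Rightarrow> real ^ 'd \<Rightarrow> real \<Rightarrow> real ^ 'd ^ 'd"
    and f fvex fcav :: "real \<Rightarrow> real \<Rightarrow> real"
    and \<phi> \<mu> \<theta> :: "real \<Rightarrow> real ^ 'd \<Rightarrow> real"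
    and t0 t1 :: real and \<Omega> V
  defines "t0 \<equiv> tgrid \<tau> n" and "t1 \<equiv> tgrid \<tau> (Suc n)"
    and "\<Omega> \<equiv> \<Union>Th" and "V \<equiv> fe_space l Th"
  assumes finite_mesh: "finite Th"
    and cells: "\<And>K. K \<in> Th \<Longrightarrow> convex K" "\<And>K. K \<in> Th \<Longrightarrow> compact K"
    and tau: "\<tau> > 0"
    and gamma: "\<gamma> > 0"
    and phi: "\<phi> t0 \<in> V" "\<phi> t1 \<in> V" "\<phi> s \<in> V"
    and mu: "\<mu> t1 \<in> V" "\<mu> s \<in> V"
    and theta: "\<theta> t0 \<in> V" "\<theta> t1 \<in> V" "\<theta> s \<in> V"
    and positive: "\<And>x. \<theta> t0 x > 0" "\<And>x. \<theta> t1 x > 0" "\<And>x. \<theta> s x > 0"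
    and coeffs: "admissible_coeff M" "admissible_coeff K" "admissible_coeff C"
    and semidefinite: "\<And>p g t \<xi>. t > 0 \<Longrightarrow>
      0 \<le> \<xi> \<bullet> (block_L (K p g t) (C p g t) (M p g t) *v \<xi>)"
    and C2: "Ck_on 2 (UNIV \<times> {0<..}) f" "Ck_on 2 (UNIV \<times> {0<..}) fvex"
      "Ck_on 2 (UNIV \<times> {0<..}) fcav"
    and f_concave: "\<And>p. concave_on {0<..} (\<lambda>t. f p t)"
    and f_split: "\<And>p t. t > 0 \<Longrightarrow> f p t = fvex p t + fcav p t"
    and fvex_convex: "\<And>t. t > 0 \<Longrightarrow> convex_on UNIV (\<lambda>p. fvex p t)"
    and fcav_concave: "\<And>t. t > 0 \<Longrightarrow> concave_on UNIV (\<lambda>p. fcav p t)"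
    and phase: "phase_equation \<Omega> V \<tau> s M C \<phi> \<mu> \<theta> n"
    and potential: "potential_equation \<Omega> V \<tau> s \<gamma> fvex fcav \<phi> \<mu> \<theta> n"
    and entropy: "entropy_equation \<Omega> V \<tau> s \<gamma> M K C f \<phi> \<mu> \<theta> n"
begin

lemma dtau_phi: "dtau \<tau> n \<phi> = (\<lambda>x. (\<phi> t1 x - \<phi> t0 x) / \<tau>)"
  by (simp add: fun_eq_iff dtau_def t0_def t1_def)

lemma dtau_phi_in_V: "dtau \<tau> n \<phi> \<in> V"
  unfolding dtau_phi V_def by (intro fe_space_diff_quotient phi[unfolded V_def])

lemma one_in_V: "(\<lambda>x. 1) \<in> V"
  by (simp add: V_def fe_space_const)

lemma continuous_on_V: "u \<in> V \<Longrightarrow> continuous_on UNIV u"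
  by (simp add: V_def fe_space_def)

lemma integrable_cellwise_bounded:
  "cellwise_bounded Th (u :: _ \<Rightarrow> real) \<Longrightarrow> set_integrable lebesgue \<Omega> u"
  unfolding \<Omega>_def by (intro cellwise_bounded_integrable finite_mesh cells)

lemma bounded_grad: "u \<in> V \<Longrightarrow> cellwise_bounded Th (grad u)"
  unfolding V_def by (rule cellwise_bounded_grad)

lemma bounded_continuous: "continuous_on UNIV u \<Longrightarrow> cellwise_bounded Th u"
  by (intro cellwise_bounded_continuous cells)

lemma bounded_coeff:
  "admissible_coeff X \<Longrightarrow> cellwise_bounded Th (coeff_at X \<phi> \<theta> s)"
  using phi(3) theta(3) positive(3)
  by (intro cellwise_bounded_coeff cells) (auto simp: V_def fe_space_def)

text \<open>Rules that follow the syntax of an integrand down to gradients, coefficients and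
  continuous scalar factors.\<close>

lemmas bounded_intros = cellwise_bounded_add cellwise_bounded_diff[OF cells(2)]
  cellwise_bounded_scaleR cellwise_bounded_inner cellwise_bounded_matrix_vector_mult
  bounded_coeff coeffs bounded_grad phi mu theta

lemmas fe_continuous = phi[THEN continuous_on_V] mu[THEN continuous_on_V]
  theta[THEN continuous_on_V]

lemma theta_nonzero: "\<theta> t1 x \<noteq> 0" "\<theta> s x \<noteq> 0"
  using positive[of x] by auto

section \<open>Mass conservation and entropy production\<close>

lemma mass_conservation: "pairing \<Omega> (dtau \<tau> n \<phi>) (\<lambda>x. 1) = 0"
  using phase[unfolded phase_equation_def Let_def, rule_format, OF one_in_V]
  by (simp add: pairing_def set_lebesgue_integral_def)

lemma entropy_production_eq:
  "pairing \<Omega> (dtau \<tau> n (discrete_entropy \<gamma> f \<phi> \<theta>)) (\<lambda>x. 1) =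
     entropy_production \<Omega> \<tau> s M K C \<phi> \<mu> \<theta> n"
proof -
  define Ms Ks Cs where "Ms = coeff_at M \<phi> \<theta> s" "Ks = coeff_at K \<phi> \<theta> s" "Cs = coeff_at C \<phi> \<theta> s"
  define A where "A x = ((1 / \<theta> s x) *\<^sub>R (Ks x *v grad (\<theta> t1) x) + Cs x *v grad (\<mu> t1) x
             - (2 * (\<mu> s x / \<theta> s x)) *\<^sub>R (Cs x *v grad (\<theta> t1) x)
             - \<mu> s x *\<^sub>R (Ms x *v grad (\<mu> t1) x)
             + ((\<mu> s x)\<^sup>2 / \<theta> s x) *\<^sub>R (Ms x *v grad (\<theta> t1) x))
           \<bullet> ((1 / ((\<theta> t1 x)\<^sup>2 * \<theta> s x)) *\<^sub>R grad (\<theta> t1) x)" for x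
  define B where "B x = ((1 / \<theta> s x) *\<^sub>R (Cs x *v grad (\<theta> t1) x) + Ms x *v grad (\<mu> t1) x
             - (\<mu> s x / \<theta> s x) *\<^sub>R (Ms x *v grad (\<theta> t1) x))
           \<bullet> ((1 / (\<theta> t1 x)\<^sup>2) *\<^sub>R grad (\<mu> t1) x)" for x
  \<comment> \<open>The gradient of the test function 1 is zero, which removes the \<gamma> term and
    half of the first test vector.\<close>
  have "pairing \<Omega> (dtau \<tau> n (discrete_entropy \<gamma> f \<phi> \<theta>)) (\<lambda>x. 1) =
      (LINT x:\<Omega>|lebesgue. A x) + (LINT x:\<Omega>|lebesgue. B x)"
    using entropy[unfolded entropy_equation_def Let_def t1_def[symmetric], rule_format,
        OF one_in_V]
    by (simp add: pairing_def A_def B_def Ms_Ks_Cs_def set_lebesgue_integral_def)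
  \<comment> \<open>The quadratic form appears only after the two integrals are merged, which
    requires each to exist.\<close>
  also have "\<dots> = (LINT x:\<Omega>|lebesgue. A x + B x)"
  proof (rule set_integral_add(2)[symmetric]; rule integrable_cellwise_bounded)
    show "cellwise_bounded Th A" "cellwise_bounded Th B"
      unfolding A_def B_def Ms_Ks_Cs_def
      by (intro bounded_intros bounded_continuous continuous_intros fe_continuous;
          simp add: theta_nonzero)+
  qed
  also have "\<dots> = entropy_production \<Omega> \<tau> s M K C \<phi> \<mu> \<theta> n"
    unfolding entropy_production_def A_def B_def Ms_Ks_Cs_def entropy_production_density Let_def
      t1_def ..
  finally show ?thesis .
qed

lemma entropy_production_nonneg: "entropy_production \<Omega> \<tau> s M K C \<phi> \<mu> \<theta> n \<ge> 0"
  unfolding entropy_production_def Let_def set_lebesgue_integral_def coeff_at_def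
  by (intro integral_nonneg_AE AE_I2 scaleR_nonneg_nonneg semidefinite positive) simp

text \<open>Keeps the energy law, which is claimed for every choice of intermediate values, from
  being vacuous. The values are chosen point by point.\<close>

lemma taylor_values_exist: "\<exists>\<zeta>1 \<zeta>2 \<zeta>3. taylor_values \<Omega> \<tau> f fvex fcav \<phi> \<theta> n \<zeta>1 \<zeta>2 \<zeta>3"
proof -
  have "\<forall>x. \<exists>z. taylor_point (\<lambda>r. f (\<phi> t0 x) r) (\<theta> t0 x) (\<theta> t1 x) z"
    "\<forall>x. \<exists>z. taylor_point (\<lambda>q. fvex q (\<theta> t1 x)) (\<phi> t1 x) (\<phi> t0 x) z"
    "\<forall>x. \<exists>z. taylor_point (\<lambda>q. fcav q (\<theta> t1 x)) (\<phi> t0 x) (\<phi> t1 x) z"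
    using taylor_point_exists2 taylor_point_exists1 C2 positive by blast+
  then show ?thesis
    unfolding taylor_values_def Let_def t0_def[symmetric] t1_def[symmetric] by metis
qed

text \<open>The remaining entropy flux is minus the phase flux tested with the chemical potential.
  That pairing is also the left side of the potential equation, whose intermediate gradient term
  occurs in the entropy equation too. Only whole pairings are added, so integrability does not
  enter.\<close>

lemma entropy_balance:
  "pairing \<Omega> (dtau \<tau> n (discrete_entropy \<gamma> f \<phi> \<theta>)) (\<theta> t1)
   + \<gamma> * pairing \<Omega> (grad (\<phi> t1)) (\<lambda>x. \<theta> t1 x *\<^sub>R grad (dtau \<tau> n \<phi>) x)
   + pairing \<Omega> (\<lambda>x. f_phi fvex fcav (\<phi> t1 x) (\<phi> t0 x) (\<theta> t1 x)) (dtau \<tau> n \<phi>) = 0"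
proof -
  define Ms Cs where "Ms = coeff_at M \<phi> \<theta> s" "Cs = coeff_at C \<phi> \<theta> s"
  define J where "J x = ((1 / \<theta> s x) *\<^sub>R (Cs x *v grad (\<theta> t1) x) + Ms x *v grad (\<mu> t1) x
             - (\<mu> s x / \<theta> s x) *\<^sub>R (Ms x *v grad (\<theta> t1) x))" for x
  \<comment> \<open>With the new temperature as test function, the vector paired with the first
    entropy flux vanishes identically.\<close>
  have zero: "(\<theta> t1 x / ((\<theta> t1 x)\<^sup>2 * \<theta> s x)) *\<^sub>R grad (\<theta> t1) x
             - (1 / (\<theta> s x * \<theta> t1 x)) *\<^sub>R grad (\<theta> t1) x = 0" for x
    using theta_nonzero[of x] by (simp add: power2_eq_square mult.commute)
  have one: "\<theta> t1 x / (\<theta> t1 x)\<^sup>2 = 1 / \<theta> t1 x" for x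
    using theta_nonzero[of x] by (simp add: power2_eq_square)
  have "pairing \<Omega> (dtau \<tau> n (discrete_entropy \<gamma> f \<phi> \<theta>)) (\<theta> t1) =
      pairing \<Omega> J (\<lambda>x. (1 / \<theta> t1 x) *\<^sub>R grad (\<mu> t1) x)
      + \<gamma> * pairing \<Omega> (grad (\<phi> s)) (\<lambda>x. dtau \<tau> n \<phi> x *\<^sub>R grad (\<theta> t1) x)"
    using entropy[unfolded entropy_equation_def Let_def t1_def[symmetric], rule_format, OF theta(2)]
    unfolding zero one J_def Ms_Cs_def by (simp add: pairing_def set_lebesgue_integral_def)
  moreover have "pairing \<Omega> (dtau \<tau> n \<phi>) (\<mu> t1) =
      - pairing \<Omega> J (\<lambda>x. (1 / \<theta> t1 x) *\<^sub>R grad (\<mu> t1) x)"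
  proof -
    have "- J x = (\<mu> s x / \<theta> s x) *\<^sub>R (Ms x *v grad (\<theta> t1) x) - Ms x *v grad (\<mu> t1) x
             - (1 / \<theta> s x) *\<^sub>R (Cs x *v grad (\<theta> t1) x)" for x
      by (simp add: J_def)
    then show ?thesis
      using phase[unfolded phase_equation_def Let_def t1_def[symmetric], rule_format, OF mu(1)]
      unfolding Ms_Cs_def[symmetric] pairing_uminus_left[symmetric] by simp
  qed
  moreover have "pairing \<Omega> (dtau \<tau> n \<phi>) (\<mu> t1) = pairing \<Omega> (\<mu> t1) (dtau \<tau> n \<phi>)"
    by (simp add: pairing_def mult.commute)
  moreover note potential[unfolded potential_equation_def Let_def t0_def[symmetric]
      t1_def[symmetric], rule_format, OF dtau_phi_in_V]
  ultimately show ?thesis by simp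
qed

section \<open>Energy dissipation for a fixed choice of Taylor values\<close>

context
  fixes \<zeta>1 \<zeta>2 \<zeta>3
  assumes taylor: "taylor_values \<Omega> \<tau> f fvex fcav \<phi> \<theta> n \<zeta>1 \<zeta>2 \<zeta>3"
begin

text \<open>Positivity of \<zeta>1, which lies between two positive temperatures, keeps it where
  \<open>f\<close> is concave and smooth.\<close>

lemma taylor_expansions:
  assumes "x \<in> \<Omega>"
  shows "\<zeta>1 x > 0"
    and "f (\<phi> t0 x) (\<theta> t1 x) = f (\<phi> t0 x) (\<theta> t0 x)
      + d2 f (\<phi> t0 x) (\<theta> t0 x) * (\<theta> t1 x - \<theta> t0 x)
      + d2 (d2 f) (\<phi> t0 x) (\<zeta>1 x) / 2 * (\<theta> t1 x - \<theta> t0 x)\<^sup>2"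
    and "fvex (\<phi> t0 x) (\<theta> t1 x) = fvex (\<phi> t1 x) (\<theta> t1 x)
      + d1 fvex (\<phi> t1 x) (\<theta> t1 x) * (\<phi> t0 x - \<phi> t1 x)
      + d1 (d1 fvex) (\<zeta>2 x) (\<theta> t1 x) / 2 * (\<phi> t0 x - \<phi> t1 x)\<^sup>2"
    and "fcav (\<phi> t1 x) (\<theta> t1 x) = fcav (\<phi> t0 x) (\<theta> t1 x)
      + d1 fcav (\<phi> t0 x) (\<theta> t1 x) * (\<phi> t1 x - \<phi> t0 x)
      + d1 (d1 fcav) (\<zeta>3 x) (\<theta> t1 x) / 2 * (\<phi> t1 x - \<phi> t0 x)\<^sup>2"
proof -
  have T: "taylor_point (\<lambda>r. f (\<phi> t0 x) r) (\<theta> t0 x) (\<theta> t1 x) (\<zeta>1 x)"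
    "taylor_point (\<lambda>q. fvex q (\<theta> t1 x)) (\<phi> t1 x) (\<phi> t0 x) (\<zeta>2 x)"
    "taylor_point (\<lambda>q. fcav q (\<theta> t1 x)) (\<phi> t0 x) (\<phi> t1 x) (\<zeta>3 x)"
    using taylor assms unfolding taylor_values_def Let_def t0_def t1_def by blast+
  show "\<zeta>1 x > 0"
    using taylor_pointD2(1)[where f = f, OF T(1)] positive(1,2)[of x]
    by (auto simp: closed_segment_eq_real_ivl split: if_splits)
  show "f (\<phi> t0 x) (\<theta> t1 x) = f (\<phi> t0 x) (\<theta> t0 x)
      + d2 f (\<phi> t0 x) (\<theta> t0 x) * (\<theta> t1 x - \<theta> t0 x)
      + d2 (d2 f) (\<phi> t0 x) (\<zeta>1 x) / 2 * (\<theta> t1 x - \<theta> t0 x)\<^sup>2"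
    by (rule taylor_pointD2(2)[where f = f, OF T(1)])
  show "fvex (\<phi> t0 x) (\<theta> t1 x) = fvex (\<phi> t1 x) (\<theta> t1 x)
      + d1 fvex (\<phi> t1 x) (\<theta> t1 x) * (\<phi> t0 x - \<phi> t1 x)
      + d1 (d1 fvex) (\<zeta>2 x) (\<theta> t1 x) / 2 * (\<phi> t0 x - \<phi> t1 x)\<^sup>2"
    by (rule taylor_pointD1[where f = fvex, OF T(2)])
  show "fcav (\<phi> t1 x) (\<theta> t1 x) = fcav (\<phi> t0 x) (\<theta> t1 x)
      + d1 fcav (\<phi> t0 x) (\<theta> t1 x) * (\<phi> t1 x - \<phi> t0 x)
      + d1 (d1 fcav) (\<zeta>3 x) (\<theta> t1 x) / 2 * (\<phi> t1 x - \<phi> t0 x)\<^sup>2"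
    by (rule taylor_pointD1[where f = fcav, OF T(3)])
qed

text \<open>The intermediate values need not depend measurably on the point; the Taylor remainders do,
  since they are differences of continuous functions.\<close>

lemma bounded_remainders:
  "cellwise_bounded Th (\<lambda>x. d2 (d2 f) (\<phi> t0 x) (\<zeta>1 x) * (dtau \<tau> n \<theta> x)\<^sup>2)" (is ?f)
  "cellwise_bounded Th (\<lambda>x. (d1 (d1 fvex) (\<zeta>2 x) (\<theta> t1 x) - d1 (d1 fcav) (\<zeta>3 x) (\<theta> t1 x))
     * (dtau \<tau> n \<phi> x)\<^sup>2)" (is ?vc)
proof -
  note cont = continuous_on_potential[OF C2(1)[THEN Ck_on_2D(1)]]
    continuous_on_potential[OF C2(1)[THEN Ck_on_2D(3)]]
    continuous_on_potential[OF C2(2)[THEN Ck_on_2D(1)]]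
    continuous_on_potential[OF C2(2)[THEN Ck_on_2D(2)]]
    continuous_on_potential[OF C2(3)[THEN Ck_on_2D(1)]]
    continuous_on_potential[OF C2(3)[THEN Ck_on_2D(2)]]
  show ?f
  proof (rule cellwise_bounded_cong)
    \<comment> \<open>The factor undoes the 1/2 of the Taylor remainder and accounts for the squared
      step size in the squared difference quotient.\<close>
    show "cellwise_bounded Th (\<lambda>x. 2 / \<tau>\<^sup>2 * (f (\<phi> t0 x) (\<theta> t1 x) - f (\<phi> t0 x) (\<theta> t0 x)
        - d2 f (\<phi> t0 x) (\<theta> t0 x) * (\<theta> t1 x - \<theta> t0 x)))"
      by (intro bounded_continuous continuous_intros cont fe_continuous positive)
    fix x assume "x \<in> \<Union>Th"
    then show "d2 (d2 f) (\<phi> t0 x) (\<zeta>1 x) * (dtau \<tau> n \<theta> x)\<^sup>2 =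
        2 / \<tau>\<^sup>2 * (f (\<phi> t0 x) (\<theta> t1 x) - f (\<phi> t0 x) (\<theta> t0 x)
        - d2 f (\<phi> t0 x) (\<theta> t0 x) * (\<theta> t1 x - \<theta> t0 x))"
      using tau taylor_expansions(2)[of x]
      by (simp add: \<Omega>_def dtau_def t0_def[symmetric] t1_def[symmetric] power_divide)
  qed
  show ?vc
  proof (rule cellwise_bounded_cong)
    let ?R = "\<lambda>x. 2 / \<tau>\<^sup>2 * ((fvex (\<phi> t0 x) (\<theta> t1 x) - fvex (\<phi> t1 x) (\<theta> t1 x)
        - d1 fvex (\<phi> t1 x) (\<theta> t1 x) * (\<phi> t0 x - \<phi> t1 x))
        - (fcav (\<phi> t1 x) (\<theta> t1 x) - fcav (\<phi> t0 x) (\<theta> t1 x)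
        - d1 fcav (\<phi> t0 x) (\<theta> t1 x) * (\<phi> t1 x - \<phi> t0 x)))"
    show "cellwise_bounded Th ?R"
      by (intro bounded_continuous continuous_intros cont fe_continuous positive)
    fix x assume "x \<in> \<Union>Th"
    then have "?R x = 2 / \<tau>\<^sup>2 * (d1 (d1 fvex) (\<zeta>2 x) (\<theta> t1 x) / 2 * (\<phi> t0 x - \<phi> t1 x)\<^sup>2
        - d1 (d1 fcav) (\<zeta>3 x) (\<theta> t1 x) / 2 * (\<phi> t1 x - \<phi> t0 x)\<^sup>2)"
      using taylor_expansions(3,4)[of x] by (simp add: \<Omega>_def)
    also have "\<dots> = (d1 (d1 fvex) (\<zeta>2 x) (\<theta> t1 x) - d1 (d1 fcav) (\<zeta>3 x) (\<theta> t1 x))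
        * (dtau \<tau> n \<phi> x)\<^sup>2"
      \<comment> \<open>The convex part is expanded backwards in time, so its increment has the
        opposite sign before squaring.\<close>
      using tau unfolding dtau_phi power2_commute[of "\<phi> t0 x"]
      by (simp add: field_simps power_divide)
    finally show "(d1 (d1 fvex) (\<zeta>2 x) (\<theta> t1 x) - d1 (d1 fcav) (\<zeta>3 x) (\<theta> t1 x))
        * (dtau \<tau> n \<phi> x)\<^sup>2 = ?R x" by simp
  qed
qed

lemma energy_dissipation_eq:
  "pairing \<Omega> (dtau \<tau> n (discrete_energy f \<phi> \<theta>)) (\<lambda>x. 1) =
     numerical_dissipation \<Omega> \<tau> \<gamma> f fvex fcav \<phi> \<theta> n \<zeta>1 \<zeta>2 \<zeta>3"
proof -
  define G where "G x = (norm (grad (dtau \<tau> n \<phi>) x))\<^sup>2 * \<theta> t1 x" for x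
  define F2 where "F2 x = d2 (d2 f) (\<phi> t0 x) (\<zeta>1 x) * (dtau \<tau> n \<theta> x)\<^sup>2" for x
  define VC where "VC x = (d1 (d1 fvex) (\<zeta>2 x) (\<theta> t1 x) - d1 (d1 fcav) (\<zeta>3 x) (\<theta> t1 x))
     * (dtau \<tau> n \<phi> x)\<^sup>2" for x
  define S where "S x = dtau \<tau> n (discrete_entropy \<gamma> f \<phi> \<theta>) x * \<theta> t1 x" for x
  define P where "P x = grad (\<phi> t1) x \<bullet> (\<theta> t1 x *\<^sub>R grad (dtau \<tau> n \<phi>) x)" for x
  define Q where "Q x = f_phi fvex fcav (\<phi> t1 x) (\<phi> t0 x) (\<theta> t1 x) * dtau \<tau> n \<phi> x" for x
  \<comment> \<open>The dissipation density plus three terms whose integrals sum to zero by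
    \<open>entropy_balance\<close>.\<close>
  define R where "R x = (- (\<tau> / 2)) * (\<gamma> * G x - F2 x + VC x) + (S x + \<gamma> * P x + Q x)" for x
  note cont = continuous_on_potential[OF C2(1)[THEN Ck_on_2D(3)]]
    continuous_on_potential[OF C2(2)[THEN Ck_on_2D(2)]]
    continuous_on_potential[OF C2(3)[THEN Ck_on_2D(2)]]
  \<comment> \<open>Squared norms become inner products and the division a constant factor, the
    forms that the closure rules cover.\<close>
  have S: "S = (\<lambda>x. (1 / \<tau>) * ((- (\<gamma> / 2) * (grad (\<phi> t1) x \<bullet> grad (\<phi> t1) x) - d2 f (\<phi> t1 x) (\<theta> t1 x))
      - (- (\<gamma> / 2) * (grad (\<phi> t0) x \<bullet> grad (\<phi> t0) x) - d2 f (\<phi> t0 x) (\<theta> t0 x))) * \<theta> t1 x)"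
    by (simp add: fun_eq_iff S_def dtau_def discrete_entropy_def entropy_density_def
        t0_def t1_def power2_norm_eq_inner)
  have G: "G = (\<lambda>x. (grad (dtau \<tau> n \<phi>) x \<bullet> grad (dtau \<tau> n \<phi>) x) * \<theta> t1 x)"
    by (simp add: fun_eq_iff G_def power2_norm_eq_inner)
  note cb = bounded_intros cellwise_bounded_mult dtau_phi_in_V bounded_continuous
    continuous_on_const cont fe_continuous positive dtau_phi_in_V[THEN continuous_on_V]
  have int: "set_integrable lebesgue \<Omega> G" "set_integrable lebesgue \<Omega> F2"
    "set_integrable lebesgue \<Omega> VC" "set_integrable lebesgue \<Omega> S"
    "set_integrable lebesgue \<Omega> P" "set_integrable lebesgue \<Omega> Q"
  proof (safe intro!: integrable_cellwise_bounded)
    show "cellwise_bounded Th G" unfolding G by (intro cb)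
    show "cellwise_bounded Th F2" "cellwise_bounded Th VC"
      unfolding F2_def VC_def by (fact bounded_remainders)+
    show "cellwise_bounded Th S" unfolding S by (intro cb)
    show "cellwise_bounded Th P" unfolding P_def by (intro cb)
    show "cellwise_bounded Th Q" unfolding Q_def f_phi_def by (intro cb)
  qed
  \<comment> \<open>The identity is claimed only in open cells, where \<open>grad\<close> commutes
    with the difference quotient; the set has the shape that the spike lemma expects.\<close>
  have "dtau \<tau> n (discrete_energy f \<phi> \<theta>) x = R x" if x: "x \<in> \<Omega> - (\<Omega> - \<Union>(interior ` Th))" for x
  proof -
    obtain K where K: "K \<in> Th" "x \<in> interior K" and x: "x \<in> \<Omega>"
      using x by blast
    have grad: "grad (dtau \<tau> n \<phi>) x = (1 / \<tau>) *\<^sub>R (grad (\<phi> t1) x - grad (\<phi> t0) x)"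
      unfolding dtau_phi by (rule grad_diff_quotient[OF phi(2,1)[unfolded V_def] K])
    show ?thesis
      unfolding R_def G_def F2_def VC_def S_def P_def Q_def grad f_phi_def
        dtau_def discrete_energy_def discrete_entropy_def energy_density_def entropy_density_def
        t0_def[symmetric] t1_def[symmetric]
      by (rule energy_identity[OF _ taylor_expansions(2-4)[OF x] f_split f_split])
        (use tau positive in auto)
  qed
  then have "(LINT x:\<Omega>|lebesgue. dtau \<tau> n (discrete_energy f \<phi> \<theta>) x) = (LINT x:\<Omega>|lebesgue. R x)"
    using negligible_outside_interiors[OF finite_mesh cells(1)] unfolding \<Omega>_def[symmetric]
    by (intro set_lebesgue_integral_spike) (auto simp: R_def int)
  also have "\<dots> = (- (\<tau> / 2)) * (\<gamma> * (LINT x:\<Omega>|lebesgue. G x) - (LINT x:\<Omega>|lebesgue. F2 x)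
       + (LINT x:\<Omega>|lebesgue. VC x))
     + ((LINT x:\<Omega>|lebesgue. S x) + \<gamma> * (LINT x:\<Omega>|lebesgue. P x) + (LINT x:\<Omega>|lebesgue. Q x))"
    unfolding R_def using int by simp
  also have "(LINT x:\<Omega>|lebesgue. S x) + \<gamma> * (LINT x:\<Omega>|lebesgue. P x) + (LINT x:\<Omega>|lebesgue. Q x) = 0"
    using entropy_balance by (simp add: pairing_def S_def P_def Q_def)
  finally show ?thesis
    unfolding numerical_dissipation_def Let_def pairing_def G_def F2_def VC_def t0_def t1_def
    by simp
qed

lemma numerical_dissipation_nonpos:
  "numerical_dissipation \<Omega> \<tau> \<gamma> f fvex fcav \<phi> \<theta> n \<zeta>1 \<zeta>2 \<zeta>3 \<le> 0"
proof -
  have nonneg: "(LINT x:\<Omega>|lebesgue. u x) \<ge> 0" if "\<And>x. x \<in> \<Omega> \<Longrightarrow> u x \<ge> 0" for u :: "_ \<Rightarrow> real"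
    unfolding set_lebesgue_integral_def using that
    by (intro integral_nonneg_AE AE_I2) (auto simp: indicator_def)
  have "(LINT x:\<Omega>|lebesgue. (norm (grad (dtau \<tau> n \<phi>) x))\<^sup>2 * \<theta> t1 x) \<ge> 0"
    using positive(2) by (intro nonneg) (simp add: less_imp_le)
  \<comment> \<open>Concavity in temperature makes this integrand nonnegative once the minus sign
    stands under the integral.\<close>
  moreover have "(LINT x:\<Omega>|lebesgue. - (d2 (d2 f) (\<phi> t0 x) (\<zeta>1 x) * (dtau \<tau> n \<theta> x)\<^sup>2)) \<ge> 0"
    using d2_d2_nonpos[OF C2(1) taylor_expansions(1) f_concave]
    by (intro nonneg) (simp add: mult_nonpos_nonneg)
  moreover have "(LINT x:\<Omega>|lebesgue. (d1 (d1 fvex) (\<zeta>2 x) (\<theta> t1 x)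
      - d1 (d1 fcav) (\<zeta>3 x) (\<theta> t1 x)) * (dtau \<tau> n \<phi> x)\<^sup>2) \<ge> 0"
  proof (intro nonneg mult_nonneg_nonneg zero_le_power2)
    fix x
    show "0 \<le> d1 (d1 fvex) (\<zeta>2 x) (\<theta> t1 x) - d1 (d1 fcav) (\<zeta>3 x) (\<theta> t1 x)"
      using d1_d1_nonneg[OF C2(2) positive(2) fvex_convex[OF positive(2)], of "\<zeta>2 x" x]
        d1_d1_nonpos[OF C2(3) positive(2) fcav_concave[OF positive(2)], of "\<zeta>3 x" x]
      by simp
  qed
  ultimately show ?thesis
    unfolding numerical_dissipation_def Let_def pairing_def t0_def[symmetric] t1_def[symmetric]
    using tau gamma
    by (intro mult_nonpos_nonneg add_nonneg_nonneg)
      (simp_all add: set_integral_uminus[OF integrable_cellwise_bounded[OF bounded_remainders(1)]]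
        mult_nonneg_nonneg add_nonneg_nonneg diff_conv_add_uminus del: add_uminus_conv_diff)
qed

end

end

section \<open>From the scheme to a single time step\<close>

lemma Pi0_in:
  "u \<in> Pi0 \<tau> N X \<Longrightarrow> t \<in> {0..tgrid \<tau> N} \<Longrightarrow> u t \<in> X"
  by (simp add: Pi0_def)

lemma Pi1c_in:
  "u \<in> Pi1c \<tau> N X \<Longrightarrow> t \<in> {0..tgrid \<tau> N} \<Longrightarrow> u t \<in> X"
  by (simp add: Pi1c_def)

theorem theorem6:
  fixes a :: "real ^ 'd" and l h T \<tau> \<gamma> lam0 lam1 :: real and N :: nat
    and Th :: "(real ^ 'd) set set"
    and M K C :: "real \<Rightarrow> real ^ 'd \<Rightarrow> real \<Rightarrow> real ^ 'd ^ 'd"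
    and f fvex fcav :: "real \<Rightarrow> real \<Rightarrow> real"
    and tstar :: "nat \<Rightarrow> real"
    and \<phi>0 \<theta>0 :: "real ^ 'd \<Rightarrow> real"
    and \<phi> \<mu> \<theta> :: "real \<Rightarrow> real ^ 'd \<Rightarrow> real"
  defines "\<Omega> \<equiv> cube a l" and "V \<equiv> fe_space l Th"
  assumes dim: "CARD('d) \<in> {1, 2, 3}"
    and cell: "l > 0"
    and mesh: "periodic_mesh a l h Th"
    and time: "\<tau> > 0" "T = real N * \<tau>"
    and tstar: "\<And>n. n < N \<Longrightarrow> tstar n \<in> {tgrid \<tau> n..tgrid \<tau> (Suc n)}"
    and gamma: "\<gamma> > 0"
    and coeffs: "admissible_coeff M" "admissible_coeff K" "admissible_coeff C"
    and ellipticity_const: "lam0 > 0" "lam1 > 0"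
    and ellipticity: "\<And>p g t \<xi>. t > 0 \<Longrightarrow>
      lam0 * (norm \<xi>)\<^sup>2 \<le> \<xi> \<bullet> (block_L (K p g t) (C p g t) (M p g t) *v \<xi>) \<and>
      \<xi> \<bullet> (block_L (K p g t) (C p g t) (M p g t) *v \<xi>) \<le> lam1 * (norm \<xi>)\<^sup>2"
    and f_smooth: "smooth_on (UNIV \<times> {0<..}) f"
    and f_concave: "\<And>p. concave_on {0<..} (\<lambda>t. f p t)"
    and f_diverges: "\<And>p. filterlim (\<lambda>t. f p t) at_infinity (at_right 0)"
    and f_split: "\<And>p t. t > 0 \<Longrightarrow> f p t = fvex p t + fcav p t"
    and split_C2: "Ck_on 2 (UNIV \<times> {0<..}) fvex" "Ck_on 2 (UNIV \<times> {0<..}) fcav"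
    and fvex_convex: "\<And>t. t > 0 \<Longrightarrow> convex_on UNIV (\<lambda>p. fvex p t)"
    and fcav_concave: "\<And>t. t > 0 \<Longrightarrow> concave_on UNIV (\<lambda>p. fcav p t)"
    and initial: "\<phi>0 \<in> V" "\<theta>0 \<in> V"
    and solution: "discrete_solution \<Omega> V \<tau> N tstar \<gamma> M K C f fvex fcav \<phi>0 \<theta>0 \<phi> \<mu> \<theta>"
    and positive: "\<And>t x. t \<in> {0..T} \<Longrightarrow> \<theta> t x > 0"
  shows "\<forall>n<N.
     pairing \<Omega> (dtau \<tau> n \<phi>) (\<lambda>x. 1) = 0 \<and>
     (\<exists>\<zeta>1 \<zeta>2 \<zeta>3. taylor_values \<Omega> \<tau> f fvex fcav \<phi> \<theta> n \<zeta>1 \<zeta>2 \<zeta>3) \<and>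
     (\<forall>\<zeta>1 \<zeta>2 \<zeta>3. taylor_values \<Omega> \<tau> f fvex fcav \<phi> \<theta> n \<zeta>1 \<zeta>2 \<zeta>3 \<longrightarrow>
        pairing \<Omega> (dtau \<tau> n (discrete_energy f \<phi> \<theta>)) (\<lambda>x. 1) =
          numerical_dissipation \<Omega> \<tau> \<gamma> f fvex fcav \<phi> \<theta> n \<zeta>1 \<zeta>2 \<zeta>3 \<and>
        numerical_dissipation \<Omega> \<tau> \<gamma> f fvex fcav \<phi> \<theta> n \<zeta>1 \<zeta>2 \<zeta>3 \<le> 0) \<and>
     pairing \<Omega> (dtau \<tau> n (discrete_entropy \<gamma> f \<phi> \<theta>)) (\<lambda>x. 1) =
       entropy_production \<Omega> \<tau> (tstar n) M K C \<phi> \<mu> \<theta> n \<and>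
     entropy_production \<Omega> \<tau> (tstar n) M K C \<phi> \<mu> \<theta> n \<ge> 0"
proof (intro allI impI)
  fix n assume n: "n < N"
  let ?t0 = "tgrid \<tau> n" and ?t1 = "tgrid \<tau> (Suc n)" and ?s = "tstar n"
  have \<Omega>: "\<Omega> = \<Union>Th" and finite: "finite Th"
    and simplices: "\<And>K. K \<in> Th \<Longrightarrow> int CARD('d) simplex K"
    using mesh unfolding periodic_mesh_def triangulation_def \<Omega>_def by auto
  have "0 \<le> ?t0" "?t0 \<le> ?t1" "?t1 \<le> tgrid \<tau> N"
    using time(1) n by (auto simp: tgrid_def intro!: mult_right_mono)
  moreover have "tgrid \<tau> N = T"
    by (simp add: tgrid_def time(2))
  ultimately have times: "t \<in> {0..tgrid \<tau> N}" "t \<in> {0..T}" if "t \<in> {?t0, ?t1, ?s}" for t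
    using that tstar[OF n] by auto
  note sol = solution[unfolded discrete_solution_def]
  \<comment> \<open>The cells cover the cube exactly, so their union can replace it as the domain of
    integration.\<close>
  interpret scheme_step Th l \<tau> ?s \<gamma> n M K C f fvex fcav \<phi> \<mu> \<theta> ?t0 ?t1 "\<Union>Th" "fe_space l Th"
  proof unfold_locales
    show "\<phi> ?t0 \<in> fe_space l Th" "\<phi> ?t1 \<in> fe_space l Th" "\<phi> ?s \<in> fe_space l Th"
      "\<theta> ?t0 \<in> fe_space l Th" "\<theta> ?t1 \<in> fe_space l Th" "\<theta> ?s \<in> fe_space l Th"
      using sol times unfolding V_def by (blast intro: Pi1c_in)+
    show "\<mu> ?t1 \<in> fe_space l Th" "\<mu> ?s \<in> fe_space l Th"
      using sol times unfolding V_def by (blast intro: Pi0_in)+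
    show "\<theta> ?t0 x > 0" "\<theta> ?t1 x > 0" "\<theta> ?s x > 0" for x
      using times by (auto intro: positive)
    \<comment> \<open>The lower ellipticity bound is itself nonnegative.\<close>
    show "0 \<le> \<xi> \<bullet> (block_L (K p g t) (C p g t) (M p g t) *v \<xi>)" if "t > 0" for p g t \<xi>
      using ellipticity[OF that, of \<xi>] ellipticity_const(1)
      by (meson less_imp_le mult_nonneg_nonneg order_trans zero_le_power2)
    show "Ck_on 2 (UNIV \<times> {0<..}) f"
      using f_smooth unfolding smooth_on_def by blast
    show "phase_equation (\<Union>Th) (fe_space l Th) \<tau> ?s M C \<phi> \<mu> \<theta> n"
      "potential_equation (\<Union>Th) (fe_space l Th) \<tau> ?s \<gamma> fvex fcav \<phi> \<mu> \<theta> n"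
      "entropy_equation (\<Union>Th) (fe_space l Th) \<tau> ?s \<gamma> M K C f \<phi> \<mu> \<theta> n"
      using sol n unfolding V_def \<Omega> by blast+
  qed (use finite simplices[THEN convex_simplex] simplices[THEN compact_simplex] time gamma coeffs split_C2 f_concave f_split fvex_convex fcav_concave
      in auto)
  show "pairing \<Omega> (dtau \<tau> n \<phi>) (\<lambda>x. 1) = 0 \<and>
     (\<exists>\<zeta>1 \<zeta>2 \<zeta>3. taylor_values \<Omega> \<tau> f fvex fcav \<phi> \<theta> n \<zeta>1 \<zeta>2 \<zeta>3) \<and>
     (\<forall>\<zeta>1 \<zeta>2 \<zeta>3. taylor_values \<Omega> \<tau> f fvex fcav \<phi> \<theta> n \<zeta>1 \<zeta>2 \<zeta>3 \<longrightarrow>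
        pairing \<Omega> (dtau \<tau> n (discrete_energy f \<phi> \<theta>)) (\<lambda>x. 1) =
          numerical_dissipation \<Omega> \<tau> \<gamma> f fvex fcav \<phi> \<theta> n \<zeta>1 \<zeta>2 \<zeta>3 \<and>
        numerical_dissipation \<Omega> \<tau> \<gamma> f fvex fcav \<phi> \<theta> n \<zeta>1 \<zeta>2 \<zeta>3 \<le> 0) \<and>
     pairing \<Omega> (dtau \<tau> n (discrete_entropy \<gamma> f \<phi> \<theta>)) (\<lambda>x. 1) =
       entropy_production \<Omega> \<tau> (tstar n) M K C \<phi> \<mu> \<theta> n \<and>
     entropy_production \<Omega> \<tau> (tstar n) M K C \<phi> \<mu> \<theta> n \<ge> 0"
    unfolding \<Omega>
    using mass_conservation taylor_values_exist energy_dissipation_eq numerical_dissipation_nonpos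
      entropy_production_eq entropy_production_nonneg by blast
qed

end
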